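(* Let $X_1,X_2,\dots$ be i.i.d. with a probability mass function $p$ on $\mathbb N$ that is strictly monotone decreasing, i.e. $p_x>p_{x+1}$ for all $x\ge0$. Then, as $n\to\infty$, $Y_n^R\Rightarrow Y$ and $Y_n^G\Rightarrow Y$ in $\ell_2$.
   Context: $\mathbb N=\{0,1,2,\dots\}$. The empirical estimator is $\widehat p_{n,x}=n^{-1}\#\{i\le n:X_i=x\}$. For a finite vector $w=(w_0,\dots,w_k)$, $\mathrm{rear}(w)$ is the vector of entries of $w$ sorted in nonincreasing order, and $\mathrm{gren}(w)$ is the vector of the $k+1$ left slopes, at $j=0,\dots,k$, of the least concave majorant of the points $\{(j,\sum_{i=0}^jw_i):j=-1,0,\dots,k\}$ (empty sum $=0$). The rearrangement estimator is $\widehat p_n^R=\mathrm{rear}(\widehat p_n)$ and the Grenander estimator (MLE) is $\widehat p_n^G=\mathrm{gren}(\widehat p_n)$; both operators are applied to the finite vector $(\widehat p_{n,x})_{0\le x\le\max_{i\le n}X_i}$, and the results are extended by $0$ to $\mathbb N$. Fluctuation processes: $Y_{n,x}^R=\sqrt n(\widehat p_{n,x}^R-p_x)$, $Y_{n,x}^G=\sqrt n(\widehat p_{n,x}^G-p_x)$. $Y=(Y_x)_{x\in\mathbb N}$ is the mean-zero Gaussian process in $\ell_2$ with $\mathrm{cov}(Y_x,Y_{x'})=p_x\delta_{x,x'}-p_xp_{x'}$. $\Rightarrow$ denotes weak convergence of random elements of $\ell_2$. *)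

theory Defs
  imports "HOL-Probability.Probability"
begin

section \<open>The Hilbert space of square-summable real sequences\<close>

typedef ell2 = "{f :: nat \<Rightarrow> real. summable (\<lambda>x. (f x)\<^sup>2)}"
  morphisms coord Abs_ell2
  by (rule exI[of _ "\<lambda>_. 0"]) simp

lemma summable_coord_square: "summable (\<lambda>x. (coord f x)\<^sup>2)"
  using coord[of f] by simp

lemma coord_Abs_ell2: "summable (\<lambda>x. (f x)\<^sup>2) \<Longrightarrow> coord (Abs_ell2 f) = f"
  by (simp add: Abs_ell2_inverse)

lemma ell2_eqI: "(\<And>x. coord f x = coord g x) \<Longrightarrow> f = g"
  by (metis coord_inject ext)

lemma summable_mult_of_squares:
  fixes f g :: "nat \<Rightarrow> real"
  assumes "summable (\<lambda>x. (f x)\<^sup>2)" "summable (\<lambda>x. (g x)\<^sup>2)"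
  shows "summable (\<lambda>x. f x * g x)"
proof (rule summable_comparison_test')
  show "summable (\<lambda>x. (f x)\<^sup>2 + (g x)\<^sup>2)"
    by (rule summable_add[OF assms])
  fix x :: nat
  have "2 * \<bar>f x * g x\<bar> \<le> (f x)\<^sup>2 + (g x)\<^sup>2"
    using sum_squares_bound[of "\<bar>f x\<bar>" "\<bar>g x\<bar>"] by (simp add: abs_mult)
  moreover have "0 \<le> \<bar>f x * g x\<bar>" by simp
  ultimately show "norm (f x * g x) \<le> (f x)\<^sup>2 + (g x)\<^sup>2"
    unfolding real_norm_def by linarith
qed

lemma summable_add_square:
  fixes f g :: "nat \<Rightarrow> real"
  assumes "summable (\<lambda>x. (f x)\<^sup>2)" "summable (\<lambda>x. (g x)\<^sup>2)"
  shows "summable (\<lambda>x. (f x + g x)\<^sup>2)"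
proof -
  have "summable (\<lambda>x. ((f x)\<^sup>2 + (g x)\<^sup>2) + 2 * (f x * g x))"
    by (intro summable_add summable_mult summable_mult_of_squares assms)
  then show ?thesis by (simp add: power2_sum mult.assoc)
qed

lemma summable_scale_square:
  fixes f :: "nat \<Rightarrow> real"
  assumes "summable (\<lambda>x. (f x)\<^sup>2)"
  shows "summable (\<lambda>x. (c * f x)\<^sup>2)"
  using summable_mult[OF assms, of "c\<^sup>2"] by (simp add: power_mult_distrib)

lemma summable_coord_mult: "summable (\<lambda>x. coord f x * coord g x)"
  by (intro summable_mult_of_squares summable_coord_square)

instantiation ell2 :: real_inner
begin

definition zero_ell2 :: ell2 where "0 = Abs_ell2 (\<lambda>_. 0)"
definition plus_ell2 :: "ell2 \<Rightarrow> ell2 \<Rightarrow> ell2"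
  where "f + g = Abs_ell2 (\<lambda>x. coord f x + coord g x)"
definition scaleR_ell2 :: "real \<Rightarrow> ell2 \<Rightarrow> ell2"
  where "c *\<^sub>R f = Abs_ell2 (\<lambda>x. c * coord f x)"
definition uminus_ell2 :: "ell2 \<Rightarrow> ell2" where "- f = (-1) *\<^sub>R (f :: ell2)"
definition minus_ell2 :: "ell2 \<Rightarrow> ell2 \<Rightarrow> ell2" where "f - g = f + - (g :: ell2)"
definition inner_ell2 :: "ell2 \<Rightarrow> ell2 \<Rightarrow> real"
  where "inner f g = (\<Sum>x. coord f x * coord g x)"
definition norm_ell2 :: "ell2 \<Rightarrow> real" where "norm f = sqrt (inner f (f :: ell2))"
definition sgn_ell2 :: "ell2 \<Rightarrow> ell2" where "sgn f = inverse (norm f) *\<^sub>R (f :: ell2)"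
definition dist_ell2 :: "ell2 \<Rightarrow> ell2 \<Rightarrow> real" where "dist f g = norm (f - g :: ell2)"
definition uniformity_ell2 :: "(ell2 \<times> ell2) filter"
  where "uniformity = (INF e\<in>{0 <..}. principal {(f, g :: ell2). dist f g < e})"
definition open_ell2 :: "ell2 set \<Rightarrow> bool"
  where "open U = (\<forall>f\<in>U. eventually (\<lambda>(f', g). f' = f \<longrightarrow> g \<in> U) (uniformity :: (ell2 \<times> ell2) filter))"

lemma coord_zero: "coord 0 x = 0"
  by (simp add: zero_ell2_def coord_Abs_ell2)

lemma coord_add: "coord (f + g) x = coord f x + coord g x"
  by (simp add: plus_ell2_def coord_Abs_ell2 summable_add_square summable_coord_square)

lemma coord_scaleR: "coord (c *\<^sub>R f) x = c * coord f x"
  by (simp add: scaleR_ell2_def coord_Abs_ell2 summable_scale_square summable_coord_square)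

lemma coord_uminus: "coord (- f) x = - coord f x"
  by (simp add: uminus_ell2_def coord_scaleR)

lemma coord_diff: "coord (f - g) x = coord f x - coord g x"
  by (simp add: minus_ell2_def coord_add coord_uminus)

instance
proof
  fix f g h :: ell2 and a b :: real
  show "f + g + h = f + (g + h)" "f + g = g + f" "0 + f = f" "- f + f = 0" "f - g = f + - g"
    "a *\<^sub>R (f + g) = a *\<^sub>R f + a *\<^sub>R g" "(a + b) *\<^sub>R f = a *\<^sub>R f + b *\<^sub>R f"
    "a *\<^sub>R b *\<^sub>R f = (a * b) *\<^sub>R f" "1 *\<^sub>R f = f"
    by (auto intro!: ell2_eqI
        simp: coord_zero coord_add coord_scaleR coord_uminus coord_diff algebra_simps)
  show "sgn f = inverse (norm f) *\<^sub>R f" by (rule sgn_ell2_def)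
  show "dist f g = norm (f - g)" by (rule dist_ell2_def)
  show "uniformity = (INF e\<in>{0 <..}. principal {(f, g :: ell2). dist f g < e})"
    by (rule uniformity_ell2_def)
  show "open U = (\<forall>f\<in>U. eventually (\<lambda>(f', g). f' = f \<longrightarrow> g \<in> U) uniformity)" for U :: "ell2 set"
    by (rule open_ell2_def)
  show "inner f g = inner g f" by (simp add: inner_ell2_def mult.commute)
  show "inner (f + g) h = inner f h + inner g h"
    by (simp add: inner_ell2_def coord_add distrib_right suminf_add summable_coord_mult)
  show "inner (a *\<^sub>R f) g = a * inner f g"
    by (simp add: inner_ell2_def coord_scaleR mult.assoc suminf_mult summable_coord_mult)
  show "0 \<le> inner f f"
    by (simp add: inner_ell2_def suminf_nonneg summable_coord_mult)
  show "inner f f = 0 \<longleftrightarrow> f = 0"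
  proof
    assume "inner f f = 0"
    then have "coord f x * coord f x = 0" for x
      using suminf_eq_zero_iff[OF summable_coord_mult, of f f] by (simp add: inner_ell2_def)
    then show "f = 0" by (auto intro!: ell2_eqI simp: coord_zero)
  qed (simp add: inner_ell2_def coord_zero)
  show "norm f = sqrt (inner f f)" by (rule norm_ell2_def)
qed

end

section \<open>Weak convergence and Gaussian processes\<close>

definition converges_weakly ::
  "'a measure \<Rightarrow> (nat \<Rightarrow> 'a \<Rightarrow> 'c::topological_space) \<Rightarrow> 'b measure \<Rightarrow> ('b \<Rightarrow> 'c) \<Rightarrow> bool"
  where "converges_weakly M Z N Y \<longleftrightarrow>
    (\<forall>n. Z n \<in> M \<rightarrow>\<^sub>M borel) \<and> Y \<in> N \<rightarrow>\<^sub>M borel \<and>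
    (\<forall>\<phi> :: 'c \<Rightarrow> real. continuous_on UNIV \<phi> \<longrightarrow> bounded (range \<phi>) \<longrightarrow>
      (\<lambda>n. \<integral>\<omega>. \<phi> (Z n \<omega>) \<partial>M) \<longlonglongrightarrow> (\<integral>\<omega>. \<phi> (Y \<omega>) \<partial>N))"

text \<open>Point masses count as (degenerate) normal laws; \<^const>\<open>normal_density\<close> with standard
  deviation \<open>0\<close> does not describe them.\<close>

definition normal_rv :: "'b measure \<Rightarrow> ('b \<Rightarrow> real) \<Rightarrow> bool"
  where "normal_rv N Z \<longleftrightarrow> Z \<in> N \<rightarrow>\<^sub>M borel \<and>
    (\<exists>m. (AE \<omega> in N. Z \<omega> = m) \<or> (\<exists>\<sigma>>0. distributed N lborel Z (normal_density m \<sigma>)))"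

definition gaussian_process :: "'b measure \<Rightarrow> ('i \<Rightarrow> 'b \<Rightarrow> real) \<Rightarrow> bool"
  where "gaussian_process N Z \<longleftrightarrow>
    (\<forall>I a. finite I \<longrightarrow> normal_rv N (\<lambda>\<omega>. \<Sum>i\<in>I. a i * Z i \<omega>))"

definition covariance :: "'b measure \<Rightarrow> ('b \<Rightarrow> real) \<Rightarrow> ('b \<Rightarrow> real) \<Rightarrow> real"
  where "covariance N U V =
    (\<integral>\<omega>. (U \<omega> - (\<integral>\<omega>'. U \<omega>' \<partial>N)) * (V \<omega> - (\<integral>\<omega>'. V \<omega>' \<partial>N)) \<partial>N)"

definition limit_process :: "nat pmf \<Rightarrow> 'b measure \<Rightarrow> ('b \<Rightarrow> ell2) \<Rightarrow> bool"
  where "limit_process p N Y \<longleftrightarrow>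
    Y \<in> N \<rightarrow>\<^sub>M borel \<and>
    gaussian_process N (\<lambda>x \<omega>. coord (Y \<omega>) x) \<and>
    (\<forall>x. (\<integral>\<omega>. coord (Y \<omega>) x \<partial>N) = 0) \<and>
    (\<forall>x x'. covariance N (\<lambda>\<omega>. coord (Y \<omega>) x) (\<lambda>\<omega>. coord (Y \<omega>) x') =
      (if x = x' then pmf p x else 0) - pmf p x * pmf p x')"

section \<open>Rearrangement and Grenander operators\<close>

definition rear :: "real list \<Rightarrow> real list"
  where "rear w = rev (sort w)"

text \<open>On an interval the pointwise infimum of all concave majorants is itself concave, hence the
  least one. Its values outside \<open>D\<close> are irrelevant.\<close>

definition least_concave_majorant :: "real set \<Rightarrow> (real \<times> real) set \<Rightarrow> real \<Rightarrow> real"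
  where "least_concave_majorant D P t =
    Inf {g t |g. concave_on D g \<and> (\<forall>(u, v)\<in>P. v \<le> g u)}"

definition left_slope :: "(real \<Rightarrow> real) \<Rightarrow> real \<Rightarrow> real"
  where "left_slope L t = (THE s. (L has_real_derivative s) (at_left t))"

text \<open>For \<open>w = (w\<^sub>0, \<dots>, w\<^sub>k)\<close> the index \<open>m\<close> is \<open>j + 1\<close> with \<open>j = -1, \<dots>, k\<close>, so that
  \<open>sum_list (take m w)\<close> is the partial sum up to \<open>w\<^sub>j\<close>.\<close>

definition cumulative_points :: "real list \<Rightarrow> (real \<times> real) set"
  where "cumulative_points w = {(real m - 1, sum_list (take m w)) |m. m \<le> length w}"

definition gren :: "real list \<Rightarrow> real list"
  where "gren w = map (\<lambda>j. left_slope
    (least_concave_majorant {-1..real (length w) - 1} (cumulative_points w)) (real j)) [0..<length w]"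

section \<open>Estimators and fluctuation processes\<close>

text \<open>The sample of size \<open>n\<close> is \<open>X 0, \<dots>, X (n - 1)\<close>. For \<open>n = 0\<close> the estimators have no meaning,
  but the fluctuation processes vanish because of the factor \<open>sqrt n\<close>.\<close>

definition empirical :: "(nat \<Rightarrow> 'a \<Rightarrow> nat) \<Rightarrow> nat \<Rightarrow> 'a \<Rightarrow> nat \<Rightarrow> real"
  where "empirical X n \<omega> x = real (card {i. i < n \<and> X i \<omega> = x}) / real n"

definition empirical_vector :: "(nat \<Rightarrow> 'a \<Rightarrow> nat) \<Rightarrow> nat \<Rightarrow> 'a \<Rightarrow> real list"
  where "empirical_vector X n \<omega> =
    map (empirical X n \<omega>) [0..<Suc (Max ((\<lambda>i. X i \<omega>) ` {..<n}))]"

definition extend_zero :: "real list \<Rightarrow> nat \<Rightarrow> real"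
  where "extend_zero w x = (if x < length w then w ! x else 0)"

definition rearrangement_estimator :: "(nat \<Rightarrow> 'a \<Rightarrow> nat) \<Rightarrow> nat \<Rightarrow> 'a \<Rightarrow> nat \<Rightarrow> real"
  where "rearrangement_estimator X n \<omega> = extend_zero (rear (empirical_vector X n \<omega>))"

definition grenander_estimator :: "(nat \<Rightarrow> 'a \<Rightarrow> nat) \<Rightarrow> nat \<Rightarrow> 'a \<Rightarrow> nat \<Rightarrow> real"
  where "grenander_estimator X n \<omega> = extend_zero (gren (empirical_vector X n \<omega>))"

definition fluctuation_R :: "nat pmf \<Rightarrow> (nat \<Rightarrow> 'a \<Rightarrow> nat) \<Rightarrow> nat \<Rightarrow> 'a \<Rightarrow> ell2"
  where "fluctuation_R p X n \<omega> =
    Abs_ell2 (\<lambda>x. sqrt (real n) * (rearrangement_estimator X n \<omega> x - pmf p x))"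

definition fluctuation_G :: "nat pmf \<Rightarrow> (nat \<Rightarrow> 'a \<Rightarrow> nat) \<Rightarrow> nat \<Rightarrow> 'a \<Rightarrow> ell2"
  where "fluctuation_G p X n \<omega> =
    Abs_ell2 (\<lambda>x. sqrt (real n) * (grenander_estimator X n \<omega> x - pmf p x))"

lemma summable_pmf_square:
  fixes p :: "nat pmf"
  shows "summable (\<lambda>x. (pmf p x)\<^sup>2)"
proof (rule summable_comparison_test')
  have "pmf p summable_on UNIV"
    by (metis abs_summable_equivalent abs_summable_summable pmf_abs_summable)
  then show "summable (pmf p)"
    by (rule summable_on_imp_summable)
  show "norm ((pmf p x)\<^sup>2) \<le> pmf p x" for x
    using mult_left_le[OF pmf_le_1[of p x] pmf_nonneg[of p x]] by (simp add: power2_eq_square)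
qed

lemma summable_fluctuation_square:
  fixes p :: "nat pmf"
  shows "summable (\<lambda>x. (c * (extend_zero w x - pmf p x))\<^sup>2)"
proof -
  have "summable (\<lambda>x. (extend_zero w x)\<^sup>2)"
    by (rule summable_finite[of "{..<length w}"]) (auto simp: extend_zero_def)
  moreover have "summable (\<lambda>x. (- 1 * pmf p x)\<^sup>2)"
    by (rule summable_scale_square[OF summable_pmf_square])
  ultimately have "summable (\<lambda>x. (extend_zero w x + - 1 * pmf p x)\<^sup>2)"
    by (rule summable_add_square)
  then show ?thesis
    by (intro summable_scale_square) simp
qed

lemma coord_fluctuation_R:
  "coord (fluctuation_R p X n \<omega>) x = sqrt (real n) * (rearrangement_estimator X n \<omega> x - pmf p x)"
  by (simp add: fluctuation_R_def rearrangement_estimator_def coord_Abs_ell2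
      summable_fluctuation_square)

lemma coord_fluctuation_G:
  "coord (fluctuation_G p X n \<omega>) x = sqrt (real n) * (grenander_estimator X n \<omega> x - pmf p x)"
  by (simp add: fluctuation_G_def grenander_estimator_def coord_Abs_ell2
      summable_fluctuation_square)

end

theory Submission
  imports Defs
begin

text \<open>Let \<open>W\<^sub>n\<close> be the fluctuation process of the empirical estimator itself. Choose weights
  \<open>c\<^sub>x\<close> increasing to infinity with \<open>\<Sum>\<^sub>x c\<^sub>x p\<^sub>x\<close> finite. The sets of all \<open>y\<close> with
  \<open>\<Sum>\<^sub>x c\<^sub>x y\<^sub>x\<^sup>2\<close> at most \<open>B\<close> are compact in the sequence space and, by Markov's inequality,
  carry almost all of the mass of every \<open>W\<^sub>n\<close> and of \<open>Y\<close>. By Stone--Weierstrass, expectations of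
  bounded continuous functions are therefore determined up to a small error by those of finite
  trigonometric sums, for which the one-dimensional central limit theorem applies; hence
  \<open>W\<^sub>n\<close> converges weakly to \<open>Y\<close>.

  Rearranging and the Grenander operator both leave alone an initial stretch of entries that is
  decreasing and dominates the rest, and both are contractions towards every decreasing sequence.
  As \<open>p\<close> is strictly decreasing, on each of those compact sets the first \<open>k\<close> entries are eventually
  untouched, and contractivity then bounds the change in the remaining ones by the tail of
  \<open>W\<^sub>n\<close>, which is uniformly small on the compact set.\<close>

section \<open>Shape operators as contractions towards decreasing sequences\<close>

text \<open>Summation by parts: the partial sums of \<open>g - w\<close> and the decrements of
  \<open>p\<close> are nonnegative, and the boundary term vanishes because the totals agree.\<close>

lemma sum_mult_antimono_mono:
  fixes g w p :: "nat \<Rightarrow> real"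
  assumes p: "\<And>x. p (Suc x) \<le> p x"
    and le: "\<And>m. m \<le> n \<Longrightarrow> sum w {..<m} \<le> sum g {..<m}"
    and eq: "sum w {..<n} = sum g {..<n}"
  shows "(\<Sum>x<n. w x * p x) \<le> (\<Sum>x<n. g x * p x)"
proof -
  \<comment> \<open>The induction carries the boundary term; its factor \<open>p m\<close> may be
    lowered to \<open>p (Suc m)\<close> since it multiplies a nonnegative number.\<close>
  have "(\<Sum>x<m. (g x - w x) * p x) \<ge> (sum g {..<m} - sum w {..<m}) * p m" if "m \<le> n" for m
    using that
  proof (induction m)
    case (Suc m)
    have "(sum g {..<Suc m} - sum w {..<Suc m}) * p (Suc m) \<le> (sum g {..<Suc m} - sum w {..<Suc m}) * p m"
      using le[OF Suc.prems] p by (intro mult_left_mono) simp_all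
    with Suc show ?case by (simp add: algebra_simps)
  qed simp
  from this[of n] show ?thesis
    by (simp add: eq algebra_simps sum_subtractf)
qed

text \<open>After expanding the squares the terms in \<open>p\<close> alone cancel, and summation by
  parts compares the cross terms.\<close>

lemma sum_square_diff_antimono_le:
  fixes g w p :: "nat \<Rightarrow> real"
  assumes "\<And>x. p (Suc x) \<le> p x"
    and "\<And>m. m \<le> n \<Longrightarrow> sum w {..<m} \<le> sum g {..<m}"
    and "sum w {..<n} = sum g {..<n}"
    and "(\<Sum>x<n. (g x)\<^sup>2) \<le> (\<Sum>x<n. (w x)\<^sup>2)"
  shows "(\<Sum>x<n. (g x - p x)\<^sup>2) \<le> (\<Sum>x<n. (w x - p x)\<^sup>2)"
  using sum_mult_antimono_mono[of p n w g] assms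
  by (simp add: power2_diff sum.distrib sum_subtractf sum_distrib_left[symmetric] mult.assoc)

text \<open>The interface between the combinatorics and the limit theorem, shared by
  \<open>rear\<close> and \<open>gren\<close>. In the locality clause \<open>j\<close> also runs
  over indices beyond \<open>k\<close>: each of the first \<open>k\<close> entries has to dominate
  everything after it.\<close>

definition shape_operator :: "(real list \<Rightarrow> real list) \<Rightarrow> bool"
  where "shape_operator T \<longleftrightarrow> (\<forall>w. w \<noteq> [] \<longrightarrow> (\<forall>x\<in>set w. 0 \<le> x) \<longrightarrow>
    length (T w) = length w \<and>
    (\<forall>k. (\<forall>i<k. \<forall>j<length w. i \<le> j \<longrightarrow> w ! j \<le> w ! i) \<longrightarrow> (\<forall>i<min k (length w). T w ! i = w ! i)) \<and>
    (\<forall>p::nat \<Rightarrow> real. (\<forall>x. p (Suc x) \<le> p x) \<longrightarrow>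
      (\<Sum>x<length w. (T w ! x - p x)\<^sup>2) \<le> (\<Sum>x<length w. (w ! x - p x)\<^sup>2)))"

subsection \<open>Rearrangement\<close>

lemma length_rear [simp]: "length (rear w) = length w"
  by (simp add: rear_def)

lemma mset_rear [simp]: "mset (rear w) = mset w"
  by (simp add: rear_def)

lemma rear_nth_antimono: "i \<le> j \<Longrightarrow> j < length w \<Longrightarrow> rear w ! j \<le> rear w ! i"
  using sorted_rev_nth_mono[of "rear w" i j] by (simp add: rear_def)

lemma rear_unique:
  assumes "mset v = mset w" "sorted (rev v)"
  shows "rear w = v"
proof -
  have "sort w = rev v"
    using assms by (intro properties_for_sort) simp_all
  then show ?thesis by (simp add: rear_def)
qed

lemma sum_rear: "(\<Sum>x<length w. h (rear w ! x)) = (\<Sum>x<length w. h (w ! x :: real) :: real)"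
proof -
  have "(\<Sum>x<length v. h (v ! x)) = sum_mset (image_mset h (mset v))" for v
    using sum_mset_sum_list[of "map h v"] by (simp add: sum_list_sum_nth atLeast0LessThan)
  from this[of w] this[of "rear w"] show ?thesis by simp
qed

text \<open>Sorting only the part after the first \<open>k\<close> entries already yields a
  nonincreasing permutation of \<open>w\<close>, and such a permutation is unique.\<close>

lemma rear_nth_eq:
  assumes le: "\<And>i j. i < k \<Longrightarrow> j < length w \<Longrightarrow> i \<le> j \<Longrightarrow> w ! j \<le> w ! i"
    and i: "i < k" "i < length w"
  shows "rear w ! i = w ! i"
proof -
  let ?v = "take k w @ rear (drop k w)"
  have "rear w = ?v"
  proof (rule rear_unique)
    show "mset ?v = mset w" by simp (simp flip: mset_append)
    have "sorted (rev (take k w))"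
      using le by (auto simp: sorted_rev_iff_nth_mono)
    moreover have "sorted (rev (rear (drop k w)))" by (simp add: rear_def)
    moreover have "y \<le> x" if "x \<in> set (take k w)" "y \<in> set (rear (drop k w))" for x y
    proof -
      have "y \<in> set (drop k w)" using that(2) by (metis mset_rear set_mset_mset)
      with that(1) show ?thesis
        using le by (auto simp: in_set_conv_nth)
    qed
    ultimately show "sorted (rev ?v)"
      by (auto simp: sorted_append)
  qed
  then show ?thesis using i by (simp add: nth_append)
qed

text \<open>The partial sums are compared through truncation at the \<open>m\<close>-th largest entry \<open>c\<close>:
  passing to the positive parts of the entries minus \<open>c\<close> loses nothing for the rearranged vector.\<close>

lemma sum_le_sum_rear:
  assumes "m \<le> length w"
  shows "(\<Sum>x<m. w ! x) \<le> (\<Sum>x<m. rear w ! x)"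
proof (cases m)
  case (Suc l)
  define c where "c = rear w ! l"
  have l: "l < length w" using assms Suc by simp
  have "(\<Sum>x<m. w ! x) \<le> (\<Sum>x<m. c + max 0 (w ! x - c))"
    by (intro sum_mono) simp
  also have "\<dots> = real m * c + (\<Sum>x<m. max 0 (w ! x - c))"
    by (simp add: sum.distrib)
  also have "(\<Sum>x<m. max 0 (w ! x - c)) \<le> (\<Sum>x<length w. max 0 (w ! x - c))"
    using assms by (intro sum_mono2) auto
  also have "\<dots> = (\<Sum>x<length w. max 0 (rear w ! x - c))"
    by (rule sum_rear[symmetric])
  also have "\<dots> = (\<Sum>x<m. max 0 (rear w ! x - c))"
    using assms Suc by (intro sum.mono_neutral_right) (auto simp: c_def max_def intro!: antisym rear_nth_antimono)
  also have "\<dots> = (\<Sum>x<m. rear w ! x - c)"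
    using rear_nth_antimono[of _ l w] l by (intro sum.cong) (auto simp: c_def Suc)
  also have "real m * c + \<dots> = (\<Sum>x<m. rear w ! x)"
    by (simp add: sum_subtractf)
  finally show ?thesis by simp
qed simp

lemma shape_operator_rear: "shape_operator rear"
  unfolding shape_operator_def
proof (intro allI impI conjI)
  fix w :: "real list" and p :: "nat \<Rightarrow> real"
  assume p: "\<forall>x. p (Suc x) \<le> p x"
  show "(\<Sum>x<length w. (rear w ! x - p x)\<^sup>2) \<le> (\<Sum>x<length w. (w ! x - p x)\<^sup>2)"
    using p sum_rear[of "\<lambda>x. x" w] sum_rear[of "\<lambda>x. x\<^sup>2" w]
    by (intro sum_square_diff_antimono_le sum_le_sum_rear) simp_all
next
  fix w :: "real list" and k i
  assume "\<forall>i<k. \<forall>j<length w. i \<le> j \<longrightarrow> w ! j \<le> w ! i" "i < min k (length w)"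
  then show "rear w ! i = w ! i" using rear_nth_eq[of k w i] by simp
qed simp

subsection \<open>Grenander operator\<close>

text \<open>Concavity cleared of denominators; in this form it also covers
  \<open>x = z\<close>.\<close>

lemma concave_on_three_points:
  fixes f :: "real \<Rightarrow> real"
  assumes f: "concave_on D f" and D: "x \<in> D" "z \<in> D" and y: "x \<le> y" "y \<le> z"
  shows "(z - y) * f x + (y - x) * f z \<le> (z - x) * f y"
proof (cases "x = z")
  case False
  define u where "u = (y - x) / (z - x)"
  have u: "0 \<le> u" "u \<le> 1" and zx: "0 < z - x"
    using y False by (auto simp: u_def)
  have ux: "u * (z - x) = y - x" using zx by (simp add: u_def)
  have "(1 - u) * f x + u * f z \<le> f ((1 - u) * x + u * z)"
    using concave_onD[OF f u D] by simp
  also have "(1 - u) * x + u * z = y" using ux by (simp add: algebra_simps)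
  finally have "(z - x) * ((1 - u) * f x + u * f z) \<le> (z - x) * f y"
    using zx by (intro mult_left_mono) simp_all
  also have "(z - x) * ((1 - u) * f x + u * f z) = ((z - x) - u * (z - x)) * f x + (u * (z - x)) * f z"
    by (simp add: algebra_simps)
  finally show ?thesis unfolding ux by simp
qed (use y in auto)

lemma sum_list_take_Suc: "m < length w \<Longrightarrow> sum_list (take (Suc m) w) = sum_list (take m w) + (w ! m :: real)"
  by (simp add: take_Suc_conv_app_nth)

lemma sum_list_take: "m \<le> length w \<Longrightarrow> sum_list (take m w) = (\<Sum>x<m. w ! x :: real)"
  by (simp add: sum_list_sum_nth atLeast0LessThan min_def)

locale nonneg_list =
  fixes w :: "real list"
  assumes nonempty: "w \<noteq> []" and nonneg: "\<And>x. x \<in> set w \<Longrightarrow> 0 \<le> x"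
begin

text \<open>Grid points are indexed from \<open>0\<close>: index \<open>m\<close> stands for the abscissa \<open>m - 1\<close>.\<close>

definition W :: "nat \<Rightarrow> real" where "W m = sum_list (take m w)"

definition D :: "real set" where "D = {-1..real (length w) - 1}"

definition L :: "real \<Rightarrow> real" where "L = least_concave_majorant D (cumulative_points w)"

definition G :: "nat \<Rightarrow> real" where "G m = L (real m - 1)"

section \<open>Bounds on the least concave majorant and its values on the grid\<close>

lemma length_pos: "0 < length w"
  using nonempty by simp

lemma W_Suc: "m < length w \<Longrightarrow> W (Suc m) = W m + w ! m"
  unfolding W_def by (rule sum_list_take_Suc)

lemma W_0: "W 0 = 0"
  by (simp add: W_def)

lemma W_mono: "i \<le> j \<Longrightarrow> j \<le> length w \<Longrightarrow> W i \<le> W j"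
  by (simp add: W_def sum_list_take) (intro sum_mono2, auto intro!: nonneg)

lemma majorant_iff: "(\<forall>(u, v)\<in>cumulative_points w. v \<le> g u) \<longleftrightarrow> (\<forall>m\<le>length w. W m \<le> g (real m - 1))"
  by (auto simp: cumulative_points_def W_def)

lemma L_eq: "L t = Inf {g t |g. concave_on D g \<and> (\<forall>m\<le>length w. W m \<le> g (real m - 1))}"
  by (simp add: L_def least_concave_majorant_def majorant_iff)

text \<open>This bounds from below the set whose infimum defines \<open>L\<close>. At the end points
  the majorant is at least \<open>W 0 = 0\<close> and the nonnegative total; concavity carries the
  sign to the interior.\<close>

lemma majorant_nonneg:
  assumes "concave_on D g" "\<And>m. m \<le> length w \<Longrightarrow> W m \<le> g (real m - 1)" "t \<in> D"
  shows "0 \<le> g t"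
proof -
  let ?n = "real (length w)"
  have t: "- 1 \<le> t" "t \<le> ?n - 1" using assms(3) by (auto simp: D_def)
  have g: "0 \<le> g (- 1)" "0 \<le> g (?n - 1)"
    using assms(2)[of 0] assms(2)[of "length w"] W_mono[of 0 "length w"] by (simp_all add: W_0)
  have "(?n - 1 - t) * g (- 1) + (t - - 1) * g (?n - 1) \<le> (?n - 1 - - 1) * g t"
    using t by (intro concave_on_three_points[OF assms(1)]) (auto simp: D_def)
  moreover have "0 \<le> (?n - 1 - t) * g (- 1) + (t - - 1) * g (?n - 1)"
    using t g by simp
  ultimately have "0 \<le> ?n * g t" by simp
  then show ?thesis using length_pos by (simp add: zero_le_mult_iff)
qed

lemma L_le:
  assumes "concave_on D g" "\<And>m. m \<le> length w \<Longrightarrow> W m \<le> g (real m - 1)" "t \<in> D"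
  shows "L t \<le> g t"
  unfolding L_eq using assms majorant_nonneg
  by (intro cInf_lower bdd_belowI[of _ 0]) auto

lemma convex_D: "convex D"
  by (simp add: D_def)

lemma concave_on_affine: "concave_on D (\<lambda>t. a + s * (t + 1))"
  unfolding concave_on_iff
proof (intro conjI ballI allI impI convex_D)
  fix x y u v :: real
  assume "u + v = 1"
  then have [simp]: "v = 1 - u" by simp
  show "u * (a + s * (x + 1)) + v * (a + s * (y + 1)) \<le> a + s * (u *\<^sub>R x + v *\<^sub>R y + 1)"
    by (simp add: algebra_simps)
qed

text \<open>The source of all explicit upper bounds on \<open>L\<close>. The shift
  \<open>t + 1\<close> makes the value at the grid point of index \<open>m\<close> equal to
  \<open>a + s * m\<close>.\<close>

lemma L_le_affine:
  assumes "\<And>m. m \<le> length w \<Longrightarrow> W m \<le> a + s * real m" "t \<in> D"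
  shows "L t \<le> a + s * (t + 1)"
  using assms by (intro L_le concave_on_affine) simp_all

lemma L_greatest:
  assumes "\<And>g. concave_on D g \<Longrightarrow> (\<And>m. m \<le> length w \<Longrightarrow> W m \<le> g (real m - 1)) \<Longrightarrow> c \<le> g t"
  shows "c \<le> L t"
  unfolding L_eq
proof (rule cInf_greatest)
  \<comment> \<open>The constant total is a majorant because \<open>W\<close> is nondecreasing, so
    the infimum is taken over a nonempty set.\<close>
  have "concave_on D (\<lambda>t. W (length w) + 0 * (t + 1))" by (rule concave_on_affine)
  then show "{g t |g. concave_on D g \<and> (\<forall>m\<le>length w. W m \<le> g (real m - 1))} \<noteq> {}"
    using W_mono by (auto intro!: exI[of _ "\<lambda>t. W (length w) + 0 * (t + 1)"])
next
  fix x
  assume "x \<in> {g t |g. concave_on D g \<and> (\<forall>m\<le>length w. W m \<le> g (real m - 1))}"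
  then obtain g where "x = g t" "concave_on D g" "\<forall>m\<le>length w. W m \<le> g (real m - 1)" by blast
  then show "c \<le> x" using assms[of g] by simp
qed

lemma W_le_G: "m \<le> length w \<Longrightarrow> W m \<le> G m"
  unfolding G_def by (intro L_greatest) auto

text \<open>Infima of concave functions are concave: every competitor \<open>g\<close> dominates
  \<open>L\<close> at \<open>x\<close> and \<open>y\<close> and is itself concave.\<close>

lemma concave_L: "concave_on D L"
  unfolding concave_on_iff
proof (intro conjI ballI allI impI convex_D)
  fix x y u v :: real
  assume xy: "x \<in> D" "y \<in> D" and uv: "0 \<le> u" "0 \<le> v" "u + v = 1"
  show "u * L x + v * L y \<le> L (u *\<^sub>R x + v *\<^sub>R y)"
  proof (rule L_greatest)
    fix g assume g: "concave_on D g" "\<And>m. m \<le> length w \<Longrightarrow> W m \<le> g (real m - 1)"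
    have "u * L x + v * L y \<le> u * g x + v * g y"
      using L_le[OF g] xy uv by (intro add_mono mult_left_mono) auto
    also have "\<dots> \<le> g (u *\<^sub>R x + v *\<^sub>R y)"
      using g(1) xy uv unfolding concave_on_iff by blast
    finally show "u * L x + v * L y \<le> g (u *\<^sub>R x + v *\<^sub>R y)" .
  qed
qed

lemma G_0: "G 0 = 0"
proof -
  \<comment> \<open>The line through the left end point with the total as slope: from index 1 on it
    is at least the total.\<close>
  have "W m \<le> 0 + W (length w) * real m" if "m \<le> length w" for m
  proof (cases m)
    case (Suc l)
    have "W m \<le> W (length w) * 1" using W_mono that by simp
    also have "\<dots> \<le> W (length w) * real m"
      using W_mono[of 0 "length w"] Suc by (intro mult_left_mono) (auto simp: W_0)
    finally show ?thesis by simp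
  qed (simp add: W_0)
  from L_le_affine[OF this, of "-1"] have "G 0 \<le> 0" by (simp add: G_def D_def)
  with W_le_G[of 0] show ?thesis by (simp add: W_0)
qed

lemma G_length: "G (length w) = W (length w)"
proof -
  have "W m \<le> W (length w) + 0 * real m" if "m \<le> length w" for m
    using W_mono that by simp
  from L_le_affine[OF this, of "real (length w) - 1"] have "G (length w) \<le> W (length w)"
    by (simp add: G_def D_def)
  with W_le_G[of "length w"] show ?thesis by simp
qed

text \<open>Outside the interval it spans, the line through two points of a concave graph lies above
  the graph; no grid index lies strictly between neighbours.\<close>

lemma G_le_chord:
  assumes "j < length w" "i \<le> length w"
  shows "G i \<le> G j + (G (Suc j) - G j) * (real i - real j)"
proof (cases "i \<le> j")
  case True
  with concave_on_three_points[OF concave_L, of "real i - 1" "real (Suc j) - 1" "real j - 1"] assms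
  show ?thesis unfolding G_def by (simp add: D_def algebra_simps)
next
  case False
  with concave_on_three_points[OF concave_L, of "real j - 1" "real i - 1" "real (Suc j) - 1"] assms
  show ?thesis unfolding G_def by (simp add: D_def algebra_simps)
qed

text \<open>Upper half: the extended chord dominates \<open>G\<close>, hence \<open>W\<close>, so it
  is an affine majorant. Lower half: concavity on the unit interval. Thus \<open>L\<close> is
  piecewise linear with kinks at grid points only.\<close>

lemma L_eq_affine:
  assumes j: "j < length w" and t: "real j - 1 \<le> t" "t \<le> real j"
  shows "L t = G j + (G (Suc j) - G j) * (t + 1 - real j)"
proof (rule antisym)
  let ?s = "G (Suc j) - G j"
  have "W m \<le> (G j - ?s * real j) + ?s * real m" if "m \<le> length w" for m
    using order_trans[OF W_le_G[OF that] G_le_chord[OF j that]] by (simp add: algebra_simps)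
  from L_le_affine[OF this, of t] show "L t \<le> G j + ?s * (t + 1 - real j)"
    using j t by (simp add: D_def algebra_simps)
  have "real j \<in> D" "real j - 1 \<in> D" using j by (auto simp: D_def)
  with concave_on_three_points[OF concave_L _ _ t]
  show "G j + ?s * (t + 1 - real j) \<le> L t"
    by (simp add: G_def algebra_simps)
qed

lemma left_slope_L:
  assumes "j < length w"
  shows "left_slope L (real j) = G (Suc j) - G j"
proof -
  let ?s = "G (Suc j) - G j"
  have "((\<lambda>t. G j + ?s * (t + 1 - real j)) has_real_derivative ?s) (at_left (real j))"
    by (auto intro!: derivative_eq_intros)
  moreover have "\<forall>\<^sub>F t in at_left (real j). L t = G j + ?s * (t + 1 - real j)"
    using eventually_at_left_real[of "real j - 1" "real j", simplified]
  proof eventually_elim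
    case (elim t)
    then show ?case using assms by (intro L_eq_affine) simp_all
  qed
  \<comment> \<open>Agreement to the left of \<open>j\<close> is not enough for the derivative; the
    values at \<open>j\<close> itself must coincide as well.\<close>
  ultimately have *: "(L has_real_derivative ?s) (at_left (real j))"
    using L_eq_affine[OF assms, of "real j"]
      has_field_derivative_cong_eventually[of L "\<lambda>t. G j + ?s * (t + 1 - real j)" "real j" "{..<real j}" ?s]
    by simp
  show ?thesis
    unfolding left_slope_def
  proof (rule the_equality)
    show "(L has_real_derivative ?s) (at_left (real j))" by (rule *)
  next
    fix s
    assume "(L has_real_derivative s) (at_left (real j))"
    from has_field_derivative_unique[OF this *] show "s = ?s" by simp
  qed
qed

section \<open>The slope vector: partial sums, norm and unchanged initial entries\<close>

lemma length_gren: "length (gren w) = length w"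
  by (simp add: gren_def)

lemma gren_nth: "j < length w \<Longrightarrow> gren w ! j = G (Suc j) - G j"
  by (simp add: gren_def left_slope_L flip: L_def D_def)

lemma sum_gren: "m \<le> length w \<Longrightarrow> (\<Sum>x<m. gren w ! x) = G m"
  by (induction m) (simp_all add: G_0 gren_nth)

text \<open>Where the majorant lies strictly above the partial sums it has no kink, because a line
  cutting off the corner would still dominate the partial sums.\<close>

lemma gren_slack:
  assumes "Suc j < length w" "W (Suc j) < G (Suc j)"
  shows "gren w ! j \<le> gren w ! Suc j"
proof (rule ccontr)
  let ?j = "Suc j"
  define a b where "a = gren w ! j" and "b = gren w ! ?j"
  assume "\<not> ?thesis"
  then have ab: "b < a" by (simp add: a_def b_def)
  \<comment> \<open>The corner is cut by a line of the mean slope \<open>s\<close> passing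
    \<open>e\<close> below it. At distance at least 1 the lines of slopes \<open>a\<close> and
    \<open>b\<close> through the corner, which bound \<open>G\<close>, have fallen below the line of
    slope \<open>s\<close> through it by at least \<open>(a - b) / 2\<close>, hence by at least
    \<open>e\<close>.\<close>
  define s where "s = (a + b) / 2"
  define e where "e = min (G ?j - W ?j) ((a - b) / 2)"
  have "0 < e" using ab assms by (simp add: e_def)
  moreover have "e \<le> G ?j - W ?j" "e \<le> (a - b) / 2"
    unfolding e_def by (rule min.cobounded1, rule min.cobounded2)
  ultimately have e: "0 < e" "e \<le> G ?j - W ?j" "e \<le> (a - b) / 2" by auto
  have "W m \<le> (G ?j - e - s * real ?j) + s * real m" if m: "m \<le> length w" for m
  proof -
    consider "m < ?j" | "m = ?j" | "?j < m" by linarith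
    then show ?thesis
    proof cases
      case 1
      have "G m \<le> G j + a * (real m - real j)"
        using G_le_chord[of j m] assms m by (simp add: a_def gren_nth)
      also have "\<dots> = G ?j + a * (real m - real ?j)"
        using assms by (simp add: a_def gren_nth algebra_simps)
      finally have *: "G m \<le> G ?j + a * (real m - real ?j)" .
      have "(a - s) * 1 \<le> (a - s) * (real ?j - real m)"
        using 1 ab by (intro mult_left_mono) (auto simp: s_def)
      then have "e \<le> (a - s) * (real ?j - real m)" using e by (simp add: s_def field_simps)
      with * W_le_G[OF m] show ?thesis by (simp add: algebra_simps)
    next
      case 2
      then show ?thesis using e by simp
    next
      case 3
      have *: "G m \<le> G ?j + b * (real m - real ?j)"
        using G_le_chord[of ?j m] assms m by (simp add: b_def gren_nth)
      have "(s - b) * 1 \<le> (s - b) * (real m - real ?j)"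
        using 3 ab by (intro mult_left_mono) (auto simp: s_def)
      then have "e \<le> (s - b) * (real m - real ?j)" using e by (simp add: s_def field_simps)
      with * W_le_G[OF m] show ?thesis by (simp add: algebra_simps)
    qed
  qed
  from L_le_affine[OF this, of "real ?j - 1"] have "G ?j \<le> G ?j - e"
    using assms by (simp add: G_def D_def algebra_simps)
  with e show False by simp
qed

text \<open>The residual \<open>d\<close> has nonnegative inner product with \<open>gren w\<close>.
  In the summation by parts a partial sum of \<open>d\<close> is either 0 or negative, and in the
  latter case \<open>gren_slack\<close> orders the adjacent slopes; the last partial sum vanishes.
  Expanding the square of \<open>gren w + d\<close> then gives the bound.\<close>

lemma sum_square_gren_le: "(\<Sum>x<length w. (gren w ! x)\<^sup>2) \<le> (\<Sum>x<length w. (w ! x)\<^sup>2)"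
proof -
  define d where "d = (\<lambda>x. w ! x - gren w ! x)"
  have d: "sum d {..<m} = W m - G m" if "m \<le> length w" for m
    using that by (simp add: d_def sum_subtractf sum_gren W_def sum_list_take)
  have "(\<Sum>x<Suc m. d x * gren w ! x) \<ge> sum d {..<Suc m} * gren w ! m" if "Suc m \<le> length w" for m
    using that
  proof (induction m)
    case (Suc m)
    have "sum d {..<Suc m} * gren w ! Suc m \<le> sum d {..<Suc m} * gren w ! m"
    proof (cases "W (Suc m) < G (Suc m)")
      case True
      then show ?thesis using gren_slack[of m] Suc.prems
        by (intro mult_left_mono_neg) (auto simp: d simp del: sum.lessThan_Suc)
    next
      case False
      then have "sum d {..<Suc m} = 0"
        using W_le_G[of "Suc m"] Suc.prems by (simp add: d del: sum.lessThan_Suc)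
      then show ?thesis by (simp del: sum.lessThan_Suc)
    qed
    with Suc show ?case by (simp add: algebra_simps)
  qed simp
  from this[of "length w - 1"] have "0 \<le> (\<Sum>x<length w. d x * gren w ! x)"
    using length_pos d[of "length w"] by (simp add: G_length del: sum.lessThan_Suc)
  moreover have "(\<Sum>x<length w. (w ! x)\<^sup>2) = (\<Sum>x<length w. (gren w ! x)\<^sup>2)
      + 2 * (\<Sum>x<length w. d x * gren w ! x) + (\<Sum>x<length w. (d x)\<^sup>2)"
    by (simp add: d_def sum_distrib_left sum.distrib[symmetric] power2_eq_square algebra_simps)
  moreover have "0 \<le> (\<Sum>x<length w. (d x)\<^sup>2)" by (simp add: sum_nonneg)
  ultimately show ?thesis by linarith
qed

text \<open>The line through the grid point \<open>m\<close> with slope \<open>w ! (m - 1)\<close>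
  dominates the partial sums: earlier entries are at least this slope, later ones at most. At
  \<open>m\<close> it equals \<open>W m\<close>.\<close>

lemma G_eq_W:
  assumes le: "\<And>i j. i < k \<Longrightarrow> j < length w \<Longrightarrow> i \<le> j \<Longrightarrow> w ! j \<le> w ! i"
    and m: "m \<le> k" "m \<le> length w"
  shows "G m = W m"
proof (cases m)
  case (Suc l)
  let ?s = "w ! l"
  have l: "l < k" "l < length w" using m Suc by simp_all
  have "W i \<le> (W m - ?s * real m) + ?s * real i" if i: "i \<le> length w" for i
  proof (cases "i \<le> m")
    case True
    then show ?thesis
    proof (induction rule: inc_induct)
      case (step i)
      then have "w ! i \<ge> ?s" using le[of i l] l Suc by simp
      with step W_Suc[of i] m show ?case by (simp add: algebra_simps)
    qed simp
  next
    case False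
    then have "m \<le> i" by simp
    then show ?thesis using i
    proof (induction rule: dec_induct)
      case (step i)
      then have "w ! i \<le> ?s" using le[of l i] l Suc by simp
      with step W_Suc[of i] show ?case by (simp add: algebra_simps)
    qed simp
  qed
  from L_le_affine[OF this, of "real m - 1"] have "G m \<le> W m"
    using m by (simp add: G_def D_def)
  with W_le_G[OF m(2)] show ?thesis by simp
qed (simp add: G_0 W_0)

lemma gren_nth_eq:
  assumes "\<And>i j. i < k \<Longrightarrow> j < length w \<Longrightarrow> i \<le> j \<Longrightarrow> w ! j \<le> w ! i"
    and "i < k" "i < length w"
  shows "gren w ! i = w ! i"
  using G_eq_W[of k "Suc i"] G_eq_W[of k i] assms by (simp add: gren_nth W_Suc)

end

lemma shape_operator_gren: "shape_operator gren"
  unfolding shape_operator_def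
proof (intro allI impI)
  fix w :: "real list"
  assume "w \<noteq> []" "\<forall>x\<in>set w. 0 \<le> x"
  then interpret nonneg_list w by unfold_locales auto
  show "length (gren w) = length w \<and>
    (\<forall>k. (\<forall>i<k. \<forall>j<length w. i \<le> j \<longrightarrow> w ! j \<le> w ! i) \<longrightarrow> (\<forall>i<min k (length w). gren w ! i = w ! i)) \<and>
    (\<forall>p::nat \<Rightarrow> real. (\<forall>x. p (Suc x) \<le> p x) \<longrightarrow>
      (\<Sum>x<length w. (gren w ! x - p x)\<^sup>2) \<le> (\<Sum>x<length w. (w ! x - p x)\<^sup>2))"
  proof (intro conjI allI impI length_gren)
    fix p :: "nat \<Rightarrow> real"
    assume "\<forall>x. p (Suc x) \<le> p x"
    then show "(\<Sum>x<length w. (gren w ! x - p x)\<^sup>2) \<le> (\<Sum>x<length w. (w ! x - p x)\<^sup>2)"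
      using sum_square_gren_le W_le_G G_length
      by (intro sum_square_diff_antimono_le) (simp_all add: sum_gren W_def sum_list_take[symmetric])
  next
    fix k i
    assume "\<forall>i<k. \<forall>j<length w. i \<le> j \<longrightarrow> w ! j \<le> w ! i" "i < min k (length w)"
    then show "gren w ! i = w ! i" using gren_nth_eq[of k i] by simp
  qed
qed

section \<open>Weighted balls of the sequence space\<close>

lemma norm_ell2_eq: "(norm f)\<^sup>2 = (\<Sum>x. (coord f x)\<^sup>2)"
  by (simp add: norm_ell2_def inner_ell2_def power2_eq_square suminf_nonneg summable_coord_mult)

lemma coord_square_le_norm: "(coord f x)\<^sup>2 \<le> (norm f)\<^sup>2"
  unfolding norm_ell2_eq using sum_le_suminf[OF summable_coord_square, of "{x}" f] by simp

lemma abs_coord_le_norm: "\<bar>coord f x\<bar> \<le> norm f"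
  using coord_square_le_norm[of f x] by (metis abs_le_square_iff abs_norm_cancel)

lemma continuous_on_coord: "continuous_on S (\<lambda>f. coord f x)"
proof (rule continuous_onI)
  fix f :: ell2 and e :: real
  assume "0 < e"
  moreover have "dist (coord g x) (coord f x) \<le> dist g f" for g
    using abs_coord_le_norm[of "g - f" x] by (simp add: dist_real_def dist_norm coord_diff)
  ultimately show "\<exists>d>0. \<forall>g\<in>S. dist g f < d \<longrightarrow> dist (coord g x) (coord f x) \<le> e"
    by (intro exI[of _ e]) (auto intro: order_trans[OF _ less_imp_le])
qed

lemma borel_measurable_coord [measurable]: "(\<lambda>f. coord f x) \<in> borel_measurable borel"
  by (intro borel_measurable_continuous_onI continuous_on_coord)

text \<open>Heads are compared directly while the two tails are bounded separately, for elements
  whose tails are small without being close coordinatewise.\<close>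

lemma norm_diff_square_le:
  "(norm (f - g))\<^sup>2 \<le> (\<Sum>x<k. (coord f x - coord g x)\<^sup>2) +
    2 * (\<Sum>x. (coord f (x + k))\<^sup>2) + 2 * (\<Sum>x. (coord g (x + k))\<^sup>2)"
proof -
  have s: "summable (\<lambda>x. (coord h (x + k))\<^sup>2)" for h
    using summable_coord_square[of h] by (simp add: summable_iff_shift[of "\<lambda>x. (coord h x)\<^sup>2"])
  have "(norm (f - g))\<^sup>2 = (\<Sum>x. (coord (f - g) (x + k))\<^sup>2) + (\<Sum>x<k. (coord (f - g) x)\<^sup>2)"
    unfolding norm_ell2_eq by (rule suminf_split_initial_segment[OF summable_coord_square])
  also have "(\<Sum>x. (coord (f - g) (x + k))\<^sup>2) \<le> (\<Sum>x. 2 * (coord f (x + k))\<^sup>2 + 2 * (coord g (x + k))\<^sup>2)"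
  proof (rule suminf_le)
    show "(coord (f - g) (x + k))\<^sup>2 \<le> 2 * (coord f (x + k))\<^sup>2 + 2 * (coord g (x + k))\<^sup>2" for x
      using zero_le_power2[of "coord f (x + k) + coord g (x + k)"]
      by (simp add: coord_diff power2_sum power2_diff)
  qed (intro s summable_add summable_mult)+
  also have "\<dots> = 2 * (\<Sum>x. (coord f (x + k))\<^sup>2) + 2 * (\<Sum>x. (coord g (x + k))\<^sup>2)"
    using s by (simp add: suminf_add[symmetric] suminf_mult[symmetric] summable_mult)
  finally show ?thesis by (simp add: coord_diff)
qed

text \<open>Bounding all partial sums avoids a summability side condition and makes the set an
  intersection of closed conditions on finitely many coordinates each.\<close>

definition weighted_ball :: "(nat \<Rightarrow> real) \<Rightarrow> real \<Rightarrow> ell2 set"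
  where "weighted_ball c B = {f. \<forall>n. (\<Sum>x<n. c x * (coord f x)\<^sup>2) \<le> B}"

text \<open>From index \<open>k\<close> on every weight is at least \<open>c k\<close>. Stated for
  plain sequences, since it is also what places them in the sequence space.\<close>

lemma weighted_tail_le:
  fixes g :: "nat \<Rightarrow> real"
  assumes c: "mono c" "\<And>x. 0 < c x" and B: "\<And>n. (\<Sum>x<n. c x * (g x)\<^sup>2) \<le> B"
  shows "summable (\<lambda>x. (g x)\<^sup>2)" "(\<Sum>x. (g (x + k))\<^sup>2) \<le> B / c k"
proof -
  have le: "(\<Sum>x<n. (g (x + k))\<^sup>2) \<le> B / c k" for n k
  proof -
    have "c k * (\<Sum>x<n. (g (x + k))\<^sup>2) \<le> (\<Sum>x<n. c (x + k) * (g (x + k))\<^sup>2)"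
      unfolding sum_distrib_left using c(1) by (intro sum_mono mult_right_mono monoD[of c]) simp_all
    also have "\<dots> = (\<Sum>x\<in>{k..<k + n}. c x * (g x)\<^sup>2)"
      using sum.shift_bounds_nat_ivl[of "\<lambda>x. c x * (g x)\<^sup>2" 0 k n]
      by (simp add: atLeast0LessThan add.commute)
    also have "\<dots> \<le> (\<Sum>x<k + n. c x * (g x)\<^sup>2)"
      using c(2) by (intro sum_mono2) (auto simp: less_imp_le)
    also have "\<dots> \<le> B" by (rule B)
    finally show ?thesis using c(2)[of k] by (simp add: field_simps)
  qed
  have "summable (\<lambda>x. (g (x + k))\<^sup>2)" for k
    using le by (intro summableI_nonneg_bounded) auto
  from this[of 0] show "summable (\<lambda>x. (g x)\<^sup>2)" by simp
  show "(\<Sum>x. (g (x + k))\<^sup>2) \<le> B / c k"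
    using le \<open>summable (\<lambda>x. (g (x + k))\<^sup>2)\<close> by (intro suminf_le_const)
qed

text \<open>In the product topology the constraints cut out a closed part of a compact box, and there
  the square-summable norm is continuous because the weights control the tails uniformly.\<close>

lemma compact_weighted_ball:
  assumes c: "mono c" "\<And>x. 0 < c x" "filterlim c at_top sequentially"
  shows "compact (weighted_ball c B)"
proof -
  define K where "K = {g::nat \<Rightarrow> real. \<forall>n. (\<Sum>x<n. c x * (g x)\<^sup>2) \<le> B}"
  define r where "r x = sqrt (B / c x)" for x
  have "compactin (product_topology (\<lambda>_. euclidean) UNIV) (PiE UNIV (\<lambda>x. {- r x..r x}))"
    by (subst compactin_PiE) auto
  then have box: "compact (PiE UNIV (\<lambda>x. {- r x..r x}))"
    by (simp add: euclidean_product_topology)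
  have "closed K"
    unfolding K_def
    by (intro closed_Collect_all closed_Collect_le continuous_intros continuous_on_product_coordinates)
  moreover have "K \<subseteq> PiE UNIV (\<lambda>x. {- r x..r x})"
  proof (rule subsetI)
    fix g assume "g \<in> K"
    then have B: "\<And>n. (\<Sum>x<n. c x * (g x)\<^sup>2) \<le> B" by (simp add: K_def)
    have "\<bar>g x\<bar> \<le> r x" for x
    proof -
      have "(\<Sum>y\<in>{x}. c y * (g y)\<^sup>2) \<le> (\<Sum>y<Suc x. c y * (g y)\<^sup>2)"
        using c(2) by (intro sum_mono2) (auto simp: less_imp_le)
      then have "(g x)\<^sup>2 \<le> B / c x"
        using B[of "Suc x"] c(2)[of x] by (simp add: field_simps)
      then show ?thesis unfolding r_def by (intro real_le_rsqrt) simp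
    qed
    then show "g \<in> PiE UNIV (\<lambda>x. {- r x..r x})"
      by (auto simp: abs_le_iff) (metis minus_le_iff)
  qed
  ultimately have "compact K"
    using compact_Int_closed[OF box] by (metis inf.absorb2)
  moreover have "continuous_on K Abs_ell2"
    unfolding continuous_on_def
  proof (intro ballI tendstoI)
    fix g and e :: real
    assume g: "g \<in> K" and e: "0 < e"
    \<comment> \<open>Each of the two tails is at most \<open>B / c k\<close> and enters doubled;
      together they use half of \<open>e\<^sup>2\<close>, leaving the other half for the first
      \<open>k\<close> coordinates.\<close>
    have "\<forall>\<^sub>F k in sequentially. 8 * \<bar>B\<bar> / e\<^sup>2 < c k"
      using c(3) by (auto simp: filterlim_at_top_dense)
    then obtain k where "8 * \<bar>B\<bar> / e\<^sup>2 < c k" by (auto simp: eventually_sequentially)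
    then have k: "4 * (B / c k) < e\<^sup>2 / 2"
      using c(2)[of k] e by (simp add: field_simps abs_if split: if_splits)
    have "((\<lambda>h. \<Sum>x<k. (h x - g x)\<^sup>2) \<longlongrightarrow> (\<Sum>x<k. (g x - g x)\<^sup>2)) (at g within K)"
      by (intro tendsto_intros)
        (metis continuous_on_def continuous_on_product_coordinates UNIV_I tendsto_within_subset subset_UNIV)
    then have "\<forall>\<^sub>F h in at g within K. (\<Sum>x<k. (h x - g x)\<^sup>2) < e\<^sup>2 / 2"
      using e by (intro order_tendstoD) auto
    moreover have "\<forall>\<^sub>F h in at g within K. h \<in> K"
      by (simp add: eventually_at_filter)
    ultimately show "\<forall>\<^sub>F h in at g within K. dist (Abs_ell2 h) (Abs_ell2 g) < e"
    proof eventually_elim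
      case (elim h)
      have KB: "\<And>n. (\<Sum>x<n. c x * (g x)\<^sup>2) \<le> B" "\<And>n. (\<Sum>x<n. c x * (h x)\<^sup>2) \<le> B"
        using g elim(2) by (auto simp: K_def)
      note tg = weighted_tail_le[OF c(1,2) KB(1)] and th = weighted_tail_le[OF c(1,2) KB(2)]
      have "(norm (Abs_ell2 h - Abs_ell2 g))\<^sup>2 \<le> (\<Sum>x<k. (h x - g x)\<^sup>2) +
          2 * (\<Sum>x. (h (x + k))\<^sup>2) + 2 * (\<Sum>x. (g (x + k))\<^sup>2)"
        using norm_diff_square_le[of "Abs_ell2 h" "Abs_ell2 g" k] by (simp add: coord_Abs_ell2 tg th)
      also have "\<dots> < e\<^sup>2"
        using tg(2)[of k] th(2)[of k] k elim(1) by simp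
      finally show ?case using e by (simp add: dist_norm power_less_imp_less_base)
    qed
  qed
  moreover have "Abs_ell2 ` K = weighted_ball c B"
  proof (intro equalityI subsetI)
    fix f assume "f \<in> weighted_ball c B"
    then have "coord f \<in> K" by (simp add: weighted_ball_def K_def)
    then show "f \<in> Abs_ell2 ` K" by (metis coord_inverse image_eqI)
  next
    fix f assume "f \<in> Abs_ell2 ` K"
    then obtain g where "g \<in> K" "f = Abs_ell2 g" by blast
    then show "f \<in> weighted_ball c B"
      using weighted_tail_le(1)[OF c(1,2), of g B] by (simp add: weighted_ball_def K_def coord_Abs_ell2)
  qed
  ultimately show ?thesis by (metis compact_continuous_image)
qed

section \<open>Weak convergence from finite-dimensional trigonometric functions\<close>

definition finite_functional :: "nat \<Rightarrow> (nat \<Rightarrow> real) \<Rightarrow> ell2 \<Rightarrow> real"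
  where "finite_functional k a f = (\<Sum>x<k. a x * coord f x)"

lemma finite_functional_pad:
  "k \<le> m \<Longrightarrow> finite_functional k a = finite_functional m (\<lambda>x. if x < k then a x else 0)"
  unfolding finite_functional_def
  by (intro ext sum.mono_neutral_cong_left) auto

lemma continuous_on_finite_functional: "continuous_on S (finite_functional k a)"
  unfolding finite_functional_def by (intro continuous_intros continuous_on_coord)

text \<open>Real trigonometric polynomials in finitely many coordinates. The phase \<open>b\<close>
  covers sines, so no complex characteristic functions are needed; generating by sums alone reduces
  every expectation to one-dimensional laws.\<close>

inductive_set trig :: "(ell2 \<Rightarrow> real) set"
  where cos: "(\<lambda>f. r * cos (finite_functional k a f + b)) \<in> trig"
  | add: "g \<in> trig \<Longrightarrow> h \<in> trig \<Longrightarrow> (\<lambda>f. g f + h f) \<in> trig"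

lemma trig_const: "(\<lambda>_. r) \<in> trig"
  using trig.cos[of r 0 "\<lambda>_. 0" 0] by (simp add: finite_functional_def)

text \<open>Padding brings both functionals to the same number of coordinates; the product-to-sum
  formula then makes \<open>trig\<close> an algebra.\<close>

lemma trig_cos_mult_cos:
  "(\<lambda>f. (r * cos (finite_functional k a f + b)) * (s * cos (finite_functional l d f + e))) \<in> trig"
proof -
  define m where "m = max k l"
  obtain a' d' where a': "finite_functional k a = finite_functional m a'"
    and d': "finite_functional l d = finite_functional m d'"
    using finite_functional_pad[of k m a] finite_functional_pad[of l m d] by (auto simp: m_def)
  have "(r * cos (finite_functional k a f + b)) * (s * cos (finite_functional l d f + e)) =
      r * s / 2 * cos (finite_functional m (\<lambda>x. a' x - d' x) f + (b - e)) +
      r * s / 2 * cos (finite_functional m (\<lambda>x. a' x + d' x) f + (b + e))" for f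
  proof -
    have "finite_functional m (\<lambda>x. a' x - d' x) f + (b - e) =
        (finite_functional m a' f + b) - (finite_functional m d' f + e)"
      "finite_functional m (\<lambda>x. a' x + d' x) f + (b + e) =
        (finite_functional m a' f + b) + (finite_functional m d' f + e)"
      by (simp_all add: finite_functional_def algebra_simps sum.distrib sum_subtractf)
    moreover have "(r * cos A) * (s * cos B) = r * s / 2 * cos (A - B) + r * s / 2 * cos (A + B)" for A B
      by (simp add: cos_add cos_diff algebra_simps)
    ultimately show ?thesis unfolding a' d' by (simp only:)
  qed
  then show ?thesis by (simp only: trig.intros)
qed

lemma trig_mult: "g \<in> trig \<Longrightarrow> h \<in> trig \<Longrightarrow> (\<lambda>f. g f * h f) \<in> trig"
proof (induction rule: trig.induct)
  case (cos r k a b)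
  then show ?case
  proof (induction rule: trig.induct)
    case (cos s l d e)
    show ?case by (rule trig_cos_mult_cos)
  next
    case (add g h)
    then show ?case using trig.add by (simp add: distrib_left)
  qed
next
  case (add g1 g2)
  then show ?case using trig.add[of "\<lambda>f. g1 f * h f" "\<lambda>f. g2 f * h f"] by (simp add: distrib_right)
qed

lemma trig_continuous: "g \<in> trig \<Longrightarrow> continuous_on S g"
  by (induction rule: trig.induct) (intro continuous_intros continuous_on_finite_functional | assumption)+

lemma trig_bounded: "g \<in> trig \<Longrightarrow> \<exists>C. \<forall>f. \<bar>g f\<bar> \<le> C"
proof (induction rule: trig.induct)
  case (cos r k a b)
  have "\<bar>r * cos (finite_functional k a f + b)\<bar> \<le> \<bar>r\<bar>" for f
    using mult_left_mono[OF abs_cos_le_one, of "\<bar>r\<bar>"] by (simp add: abs_mult)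
  then show ?case by blast
next
  case (add g h)
  then obtain C E where "\<forall>f. \<bar>g f\<bar> \<le> C" "\<forall>f. \<bar>h f\<bar> \<le> E" by blast
  then have "\<bar>g f + h f\<bar> \<le> C + E" for f
    using abs_triangle_ineq[of "g f" "h f"] add_mono[of "\<bar>g f\<bar>" C "\<bar>h f\<bar>" E] by fastforce
  then show ?case by blast
qed

lemma trig_separable:
  assumes "f \<noteq> g"
  shows "\<exists>h\<in>trig. h f \<noteq> h g"
proof -
  obtain x where x: "coord f x \<noteq> coord g x" using assms ell2_eqI by blast
  \<comment> \<open>The scale turns the gap between the two coordinates into \<open>pi\<close>, so
    \<open>h\<close> takes the values \<open>cos 0\<close> and \<open>cos pi\<close>.\<close>
  define t where "t = pi / (coord g x - coord f x)"
  define h where "h = (\<lambda>u. 1 * cos (finite_functional (Suc x) (\<lambda>y. if y = x then t else 0) u + - t * coord f x))"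
  have "finite_functional (Suc x) (\<lambda>y. if y = x then t else 0) u = t * coord u x" for u
    by (simp add: finite_functional_def if_distrib[of "\<lambda>s. s * _"] cong: if_cong)
  then have h: "h u = cos (t * coord u x - t * coord f x)" for u by (simp add: h_def)
  have "t * (coord g x - coord f x) = pi"
    using x by (simp add: t_def)
  then have "t * coord g x - t * coord f x = pi"
    by (simp only: right_diff_distrib)
  then have "h f \<noteq> h g" by (simp add: h)
  moreover have "h \<in> trig" unfolding h_def by (rule trig.cos)
  ultimately show ?thesis by blast
qed

lemma trig_polynomial:
  assumes "real_polynomial_function (q :: real \<Rightarrow> real)" "g \<in> trig"
  shows "(\<lambda>f. q (g f)) \<in> trig"
  using assms(1)
proof (induction rule: real_polynomial_function.induct)
  case (linear q)
  then interpret bounded_linear q .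
  have "q u = q 1 * u" for u using scale[of u 1] by simp
  then have "(\<lambda>f. q (g f)) = (\<lambda>f. q 1 * g f)" by blast
  then show ?case using trig_mult[OF trig_const[of "q 1"] assms(2)] by (simp only:)
qed (auto intro: trig_const trig.add trig_mult)

text \<open>Stone--Weierstrass only controls the approximant on \<open>K\<close>; composing it with a
  polynomial that approximates the truncation to \<open>[-C, C]\<close> bounds it everywhere.\<close>

lemma trig_approximation:
  assumes K: "compact K" and \<phi>: "continuous_on K \<phi>" "\<And>f. f \<in> K \<Longrightarrow> \<bar>\<phi> f\<bar> \<le> C" and "0 \<le> C" "0 < \<delta>"
  shows "\<exists>g\<in>trig. (\<forall>f. \<bar>g f\<bar> \<le> C + \<delta>) \<and> (\<forall>f\<in>K. \<bar>\<phi> f - g f\<bar> \<le> 2 * \<delta>)"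
proof -
  interpret function_ring_on trig K
    using K by unfold_locales (auto intro: trig_continuous trig.add trig_mult trig_const trig_separable)
  obtain g where g: "g \<in> trig" "\<forall>f\<in>K. \<bar>\<phi> f - g f\<bar> < \<delta>"
    using Stone_Weierstrass_basic[OF \<phi>(1) \<open>0 < \<delta>\<close>] by blast
  obtain E where E: "\<forall>f. \<bar>g f\<bar> \<le> E" using trig_bounded[OF g(1)] by blast
  define \<kappa> where "\<kappa> = (\<lambda>u. max (- C) (min C u))"
  have "continuous_on {-E..E} \<kappa>" unfolding \<kappa>_def by (intro continuous_intros)
  then obtain q where q: "real_polynomial_function q" "\<And>u. u \<in> {-E..E} \<Longrightarrow> \<bar>\<kappa> u - q u\<bar> < \<delta>"
    using Stone_Weierstrass_real_polynomial_function[of "{-E..E}" \<kappa> \<delta>] \<open>0 < \<delta>\<close> by (metis compact_Icc)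
  have q': "\<bar>\<kappa> (g f) - q (g f)\<bar> < \<delta>" for f
    using E[rule_format, of f] by (intro q) (auto simp: abs_le_iff)
  have "\<bar>q (g f)\<bar> \<le> C + \<delta>" for f
  proof -
    have "\<bar>\<kappa> (g f)\<bar> \<le> C" using \<open>0 \<le> C\<close> by (auto simp: \<kappa>_def)
    with q'[of f] show ?thesis by linarith
  qed
  moreover have "\<bar>\<phi> f - q (g f)\<bar> \<le> 2 * \<delta>" if "f \<in> K" for f
  proof -
    have "\<bar>\<phi> f - \<kappa> (g f)\<bar> < \<delta>"
      using g(2) that \<phi>(2)[OF that] unfolding \<kappa>_def by (auto simp: max_def min_def)
    with q'[of f] show ?thesis by linarith
  qed
  ultimately show ?thesis
    using trig_polynomial[OF q(1) g(1)] by (intro bexI[of _ "\<lambda>f. q (g f)"]) auto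
qed

section \<open>Transfer of weak convergence by splitting at exceptional events\<close>

lemma (in prob_space) expectation_diff_le:
  fixes u v :: "'a \<Rightarrow> real"
  assumes int: "integrable M u" "integrable M v" and A: "{\<omega>\<in>space M. \<omega> \<in> A} \<in> events"
    and le: "\<And>\<omega>. \<omega> \<in> space M \<Longrightarrow> \<omega> \<notin> A \<Longrightarrow> \<bar>u \<omega> - v \<omega>\<bar> \<le> a"
      "\<And>\<omega>. \<omega> \<in> space M \<Longrightarrow> \<bar>u \<omega> - v \<omega>\<bar> \<le> b" and "0 \<le> a"
  shows "\<bar>expectation u - expectation v\<bar> \<le> a + b * prob {\<omega>\<in>space M. \<omega> \<in> A}"
proof -
  let ?A = "{\<omega>\<in>space M. \<omega> \<in> A}"
  have "\<bar>expectation u - expectation v\<bar> = \<bar>expectation (\<lambda>\<omega>. u \<omega> - v \<omega>)\<bar>"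
    using int by simp
  also have "\<dots> \<le> expectation (\<lambda>\<omega>. \<bar>u \<omega> - v \<omega>\<bar>)"
    by (rule integral_abs_bound)
  also have "\<dots> \<le> expectation (\<lambda>\<omega>. a + b * indicator ?A \<omega>)"
  proof (rule integral_mono)
    show "integrable M (\<lambda>\<omega>. \<bar>u \<omega> - v \<omega>\<bar>)" using int by simp
    show "integrable M (\<lambda>\<omega>. a + b * indicator ?A \<omega>)"
      using A by (intro Bochner_Integration.integrable_add integrable_const Bochner_Integration.integrable_mult_right) (simp add: less_top[symmetric])
    show "\<bar>u \<omega> - v \<omega>\<bar> \<le> a + b * indicator ?A \<omega>" if "\<omega> \<in> space M" for \<omega>
      using le(1)[of \<omega>] le(2)[of \<omega>] \<open>0 \<le> a\<close> that by (cases "\<omega> \<in> A") auto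
  qed
  also have "\<dots> = a + b * prob ?A"
    using A by (simp add: less_top[symmetric] prob_space)
  finally show ?thesis .
qed

lemma (in prob_space) integrable_bounded_continuous:
  fixes \<phi> :: "'c::topological_space \<Rightarrow> real"
  assumes "continuous_on UNIV \<phi>" "\<And>x. \<bar>\<phi> x\<bar> \<le> C" "Z \<in> M \<rightarrow>\<^sub>M borel"
  shows "integrable M (\<lambda>\<omega>. \<phi> (Z \<omega>))"
  using assms by (intro integrable_const_bound[of _ C] AE_I2 measurable_compose[OF assms(3)]
      borel_measurable_continuous_onI) auto

text \<open>On a compact set of large mass the test function is replaced by a trigonometric sum; off
  it the error is bounded and the mass small.\<close>

lemma converges_weakly_if_trig:
  fixes Z :: "nat \<Rightarrow> 'a \<Rightarrow> ell2" and Y :: "'b \<Rightarrow> ell2"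
  assumes M: "prob_space M" and N: "prob_space N"
    and Z: "\<And>n. Z n \<in> M \<rightarrow>\<^sub>M borel" and Y: "Y \<in> N \<rightarrow>\<^sub>M borel"
    and conv: "\<And>k a b. (\<lambda>n. \<integral>\<omega>. cos (finite_functional k a (Z n \<omega>) + b) \<partial>M)
      \<longlonglongrightarrow> (\<integral>\<omega>. cos (finite_functional k a (Y \<omega>) + b) \<partial>N)"
    and tight: "\<And>\<epsilon>. 0 < \<epsilon> \<Longrightarrow> \<exists>K. compact K \<and> (\<forall>n. measure M {\<omega>\<in>space M. Z n \<omega> \<notin> K} \<le> \<epsilon>) \<and>
      measure N {\<omega>\<in>space N. Y \<omega> \<notin> K} \<le> \<epsilon>"
  shows "converges_weakly M Z N Y"
  unfolding converges_weakly_def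
proof (intro conjI allI impI Z Y)
  interpret M: prob_space M by fact
  interpret N: prob_space N by fact
  have int: "integrable M (\<lambda>\<omega>. g (Z n \<omega>))" "integrable N (\<lambda>\<omega>. g (Y \<omega>))" if "g \<in> trig" for g n
  proof -
    obtain C where "\<And>f. \<bar>g f\<bar> \<le> C" using trig_bounded[OF \<open>g \<in> trig\<close>] by blast
    from trig_continuous[OF that] this show "integrable M (\<lambda>\<omega>. g (Z n \<omega>))" "integrable N (\<lambda>\<omega>. g (Y \<omega>))"
      using M.integrable_bounded_continuous[OF _ _ Z] N.integrable_bounded_continuous[OF _ _ Y] by blast+
  qed
  have trig_conv: "(\<lambda>n. \<integral>\<omega>. g (Z n \<omega>) \<partial>M) \<longlonglongrightarrow> (\<integral>\<omega>. g (Y \<omega>) \<partial>N)" if "g \<in> trig" for g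
    using that
  proof (induction rule: trig.induct)
    case (cos r k a b)
    show ?case using tendsto_mult[OF tendsto_const conv] by simp
  next
    case (add g h)
    then show ?case using tendsto_add[OF add.IH] by (simp add: int)
  qed
  fix \<phi> :: "ell2 \<Rightarrow> real"
  assume \<phi>: "continuous_on UNIV \<phi>" "bounded (range \<phi>)"
  then obtain C where "\<forall>f. \<bar>\<phi> f\<bar> \<le> C" by (auto simp: bounded_iff)
  then have C: "\<bar>\<phi> f\<bar> \<le> C" and "0 \<le> C" for f by (auto intro: order_trans[OF abs_ge_zero])
  have int\<phi>: "integrable M (\<lambda>\<omega>. \<phi> (Z n \<omega>))" "integrable N (\<lambda>\<omega>. \<phi> (Y \<omega>))" for n
    using M.integrable_bounded_continuous[OF \<phi>(1) C Z] N.integrable_bounded_continuous[OF \<phi>(1) C Y] by auto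
  show "(\<lambda>n. \<integral>\<omega>. \<phi> (Z n \<omega>) \<partial>M) \<longlonglongrightarrow> (\<integral>\<omega>. \<phi> (Y \<omega>) \<partial>N)"
  proof (rule LIMSEQ_I)
    fix r :: real assume "0 < r"
    \<comment> \<open>The replacement costs \<open>(2 * C + 3) * \<delta>\<close> on each side and
      the limit less than \<open>\<delta>\<close>, in total less than
      \<open>2 * (2 * C + 4) * \<delta>\<close>. The cap at 1 bounds the error off \<open>K\<close>
      by \<open>2 * C + 1\<close>.\<close>
    define \<delta> where "\<delta> = min 1 (r / (2 * (2 * C + 4)))"
    have \<delta>: "0 < \<delta>" "\<delta> \<le> 1" using \<open>0 < r\<close> \<open>0 \<le> C\<close> by (auto simp: \<delta>_def)
    have "\<delta> \<le> r / (2 * (2 * C + 4))" unfolding \<delta>_def by (rule min.cobounded2)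
    then have \<delta>r: "2 * (2 * C + 4) * \<delta> \<le> r" using \<open>0 \<le> C\<close> by (simp add: field_simps)
    obtain K where K: "compact K" "\<And>n. measure M {\<omega>\<in>space M. Z n \<omega> \<notin> K} \<le> \<delta>"
      "measure N {\<omega>\<in>space N. Y \<omega> \<notin> K} \<le> \<delta>"
      using tight[OF \<delta>(1)] by blast
    obtain g where g: "g \<in> trig" "\<And>f. \<bar>g f\<bar> \<le> C + \<delta>" "\<And>f. f \<in> K \<Longrightarrow> \<bar>\<phi> f - g f\<bar> \<le> 2 * \<delta>"
      using trig_approximation[OF K(1) continuous_on_subset[OF \<phi>(1) subset_UNIV] C \<open>0 \<le> C\<close> \<delta>(1)] by blast
    have b: "\<bar>\<phi> f - g f\<bar> \<le> 2 * C + 1" for f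
      using C[of f] g(2)[of f] \<delta> by linarith
    have [measurable]: "K \<in> sets borel" using K(1) by (simp add: compact_imp_closed)
    note [measurable] = Z Y
    have le: "2 * \<delta> + (2 * C + 1) * t \<le> (2 * C + 3) * \<delta>" if "t \<le> \<delta>" for t
      using mult_left_mono[OF that, of "2 * C + 1"] \<open>0 \<le> C\<close> by (simp add: algebra_simps)
    have "\<bar>(\<integral>\<omega>. \<phi> (Z n \<omega>) \<partial>M) - (\<integral>\<omega>. g (Z n \<omega>) \<partial>M)\<bar>
        \<le> 2 * \<delta> + (2 * C + 1) * M.prob {\<omega>\<in>space M. \<omega> \<in> {\<omega>. Z n \<omega> \<notin> K}}" for n
      using g(3) b \<delta> by (intro M.expectation_diff_le int\<phi> int g(1)) auto
    then have 1: "\<bar>(\<integral>\<omega>. \<phi> (Z n \<omega>) \<partial>M) - (\<integral>\<omega>. g (Z n \<omega>) \<partial>M)\<bar> \<le> (2 * C + 3) * \<delta>" for n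
      by (intro order_trans[OF _ le[OF K(2)[of n]]]) simp
    have "\<bar>(\<integral>\<omega>. \<phi> (Y \<omega>) \<partial>N) - (\<integral>\<omega>. g (Y \<omega>) \<partial>N)\<bar>
        \<le> 2 * \<delta> + (2 * C + 1) * N.prob {\<omega>\<in>space N. \<omega> \<in> {\<omega>. Y \<omega> \<notin> K}}"
      using g(3) b \<delta> by (intro N.expectation_diff_le int\<phi> int g(1)) auto
    then have 2: "\<bar>(\<integral>\<omega>. \<phi> (Y \<omega>) \<partial>N) - (\<integral>\<omega>. g (Y \<omega>) \<partial>N)\<bar> \<le> (2 * C + 3) * \<delta>"
      by (intro order_trans[OF _ le[OF K(3)]]) simp
    obtain n0 where n0: "\<And>n. n \<ge> n0 \<Longrightarrow> norm ((\<integral>\<omega>. g (Z n \<omega>) \<partial>M) - (\<integral>\<omega>. g (Y \<omega>) \<partial>N)) < \<delta>"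
      using LIMSEQ_D[OF trig_conv[OF g(1)] \<delta>(1)] by blast
    have "norm ((\<integral>\<omega>. \<phi> (Z n \<omega>) \<partial>M) - (\<integral>\<omega>. \<phi> (Y \<omega>) \<partial>N)) < r" if "n \<ge> n0" for n
      using 1[of n] 2 n0[OF that] \<delta>r \<delta>(1) unfolding real_norm_def by (simp add: algebra_simps)
    then show "\<exists>n0. \<forall>n\<ge>n0. norm ((\<integral>\<omega>. \<phi> (Z n \<omega>) \<partial>M) - (\<integral>\<omega>. \<phi> (Y \<omega>) \<partial>N)) < r" by blast
  qed
qed

text \<open>Stronger than uniform continuity on \<open>K\<close>, since \<open>y\<close> may leave
  \<open>K\<close>, as a perturbed process does. A counterexample sequence would have a subsequence
  with both members tending to the same limit.\<close>

lemma continuous_near_compact: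
  fixes \<phi> :: "'c::metric_space \<Rightarrow> 'd::metric_space"
  assumes "compact K" "continuous_on UNIV \<phi>" "0 < e"
  shows "\<exists>\<delta>>0. \<forall>x\<in>K. \<forall>y. dist y x < \<delta> \<longrightarrow> dist (\<phi> y) (\<phi> x) < e"
proof (rule ccontr)
  assume "\<not> ?thesis"
  then have "\<forall>n. \<exists>x y. x \<in> K \<and> dist y x < inverse (real (Suc n)) \<and> e \<le> dist (\<phi> y) (\<phi> x)"
    by (metis inverse_positive_iff_positive not_less of_nat_0_less_iff zero_less_Suc)
  then obtain x y where xy: "\<And>n. x n \<in> K" "\<And>n. dist (y n) (x n) < inverse (real (Suc n))"
    "\<And>n. e \<le> dist (\<phi> (y n)) (\<phi> (x n))"
    by metis
  obtain l s where l: "strict_mono s" "(x \<circ> s) \<longlonglongrightarrow> l"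
    using assms(1) xy(1) unfolding compact_def by blast
  have "(\<lambda>n. dist (y n) (x n)) \<longlonglongrightarrow> 0"
  proof (rule tendsto_sandwich[OF _ _ tendsto_const LIMSEQ_inverse_real_of_nat])
    show "\<forall>\<^sub>F n in sequentially. dist (y n) (x n) \<le> inverse (real (Suc n))"
      using xy(2) by (intro always_eventually allI less_imp_le)
  qed simp
  from tendsto_add[OF LIMSEQ_subseq_LIMSEQ[OF this l(1)] l(2)[unfolded tendsto_dist_iff[of _ l]]]
  have "(\<lambda>n. dist (y (s n)) (x (s n)) + dist (x (s n)) l) \<longlonglongrightarrow> 0"
    by (simp add: o_def)
  from tendsto_sandwich[OF _ _ tendsto_const this, of "\<lambda>n. dist (y (s n)) l"]
  have "(\<lambda>n. dist (y (s n)) l) \<longlonglongrightarrow> 0" by (simp add: dist_triangle)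
  then have "(y \<circ> s) \<longlonglongrightarrow> l" by (subst tendsto_dist_iff) (simp add: o_def)
  then have "(\<lambda>n. dist (\<phi> ((y \<circ> s) n)) (\<phi> ((x \<circ> s) n))) \<longlonglongrightarrow> dist (\<phi> l) (\<phi> l)"
    using l(2) assms(2) by (intro tendsto_dist continuous_on_tendsto_compose[OF assms(2)]) (simp_all add: o_def)
  then have "\<forall>\<^sub>F n in sequentially. dist (\<phi> ((y \<circ> s) n)) (\<phi> ((x \<circ> s) n)) < e"
    using assms(3) by (intro order_tendstoD) auto
  then obtain n where "dist (\<phi> ((y \<circ> s) n)) (\<phi> ((x \<circ> s) n)) < e"
    by (auto simp: eventually_sequentially)
  with xy(3)[of "s n"] show False by simp
qed

text \<open>A Slutsky-type statement: closeness is required only on the event that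
  \<open>W n\<close> lies in \<open>K\<close>, but there uniformly in
  \<open>\<omega>\<close>.\<close>

lemma converges_weakly_perturb:
  fixes W Z :: "nat \<Rightarrow> 'a \<Rightarrow> 'c::metric_space" and Y :: "'b \<Rightarrow> 'c"
  assumes M: "prob_space M" and W: "converges_weakly M W N Y"
    and Z: "\<And>n. Z n \<in> M \<rightarrow>\<^sub>M borel"
    and tight: "\<And>\<epsilon>. 0 < \<epsilon> \<Longrightarrow> \<exists>K. compact K \<and> (\<forall>n. measure M {\<omega>\<in>space M. W n \<omega> \<notin> K} \<le> \<epsilon>) \<and>
      (\<forall>\<delta>>0. \<forall>\<^sub>F n in sequentially. \<forall>\<omega>\<in>space M. W n \<omega> \<in> K \<longrightarrow> dist (Z n \<omega>) (W n \<omega>) < \<delta>)"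
  shows "converges_weakly M Z N Y"
  unfolding converges_weakly_def
proof (intro conjI allI impI Z)
  interpret M: prob_space M by fact
  have [measurable]: "\<And>n. W n \<in> M \<rightarrow>\<^sub>M borel" and "Y \<in> N \<rightarrow>\<^sub>M borel"
    and conv: "\<And>\<phi> :: 'c \<Rightarrow> real. continuous_on UNIV \<phi> \<Longrightarrow> bounded (range \<phi>) \<Longrightarrow>
      (\<lambda>n. \<integral>\<omega>. \<phi> (W n \<omega>) \<partial>M) \<longlonglongrightarrow> (\<integral>\<omega>. \<phi> (Y \<omega>) \<partial>N)"
    using W by (auto simp: converges_weakly_def)
  show "Y \<in> N \<rightarrow>\<^sub>M borel" by fact
  fix \<phi> :: "'c \<Rightarrow> real"
  assume \<phi>: "continuous_on UNIV \<phi>" "bounded (range \<phi>)"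
  then obtain C where "\<forall>f. \<bar>\<phi> f\<bar> \<le> C" by (auto simp: bounded_iff)
  then have C: "\<bar>\<phi> f\<bar> \<le> C" and "0 \<le> C" for f by (auto intro: order_trans[OF abs_ge_zero])
  have int: "integrable M (\<lambda>\<omega>. \<phi> (Z n \<omega>))" "integrable M (\<lambda>\<omega>. \<phi> (W n \<omega>))" for n
    using M.integrable_bounded_continuous[OF \<phi>(1) C] Z by auto
  have "(\<lambda>n. (\<integral>\<omega>. \<phi> (Z n \<omega>) \<partial>M) - (\<integral>\<omega>. \<phi> (W n \<omega>) \<partial>M)) \<longlonglongrightarrow> 0"
  proof (rule tendstoI)
    fix r :: real assume "0 < r"
    \<comment> \<open>The error is \<open>\<epsilon>\<close> on \<open>K\<close> and at most
      \<open>2 * C\<close> off it, on mass at most \<open>\<epsilon>\<close>; the sum is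
      \<open>r / 2\<close>.\<close>
    define \<epsilon> where "\<epsilon> = (r / 2) / (2 * C + 1)"
    have \<epsilon>: "0 < \<epsilon>" using \<open>0 < r\<close> \<open>0 \<le> C\<close> by (auto simp: \<epsilon>_def)
    have "(2 * C + 1) * \<epsilon> = r / 2"
      unfolding \<epsilon>_def using nonzero_mult_div_cancel_left[of "2 * C + 1" "r / 2"] \<open>0 \<le> C\<close> by simp
    then have \<epsilon>r: "2 * C * \<epsilon> + \<epsilon> < r" using \<open>0 < r\<close> by (simp add: algebra_simps)
    obtain K where K: "compact K" "\<And>n. measure M {\<omega>\<in>space M. W n \<omega> \<notin> K} \<le> \<epsilon>"
      and close: "\<And>\<delta>. 0 < \<delta> \<Longrightarrow> \<forall>\<^sub>F n in sequentially. \<forall>\<omega>\<in>space M. W n \<omega> \<in> K \<longrightarrow> dist (Z n \<omega>) (W n \<omega>) < \<delta>"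
      using tight[OF \<epsilon>] by blast
    obtain \<delta> where \<delta>: "0 < \<delta>" "\<And>x y. x \<in> K \<Longrightarrow> dist y x < \<delta> \<Longrightarrow> dist (\<phi> y) (\<phi> x) < \<epsilon>"
      using continuous_near_compact[OF K(1) \<phi>(1) \<epsilon>] by blast
    have [measurable]: "K \<in> sets borel" using K(1) by (simp add: compact_imp_closed)
    from close[OF \<delta>(1)] show "\<forall>\<^sub>F n in sequentially. dist ((\<integral>\<omega>. \<phi> (Z n \<omega>) \<partial>M) - (\<integral>\<omega>. \<phi> (W n \<omega>) \<partial>M)) 0 < r"
    proof eventually_elim
      case (elim n)
      have "\<bar>(\<integral>\<omega>. \<phi> (Z n \<omega>) \<partial>M) - (\<integral>\<omega>. \<phi> (W n \<omega>) \<partial>M)\<bar>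
          \<le> \<epsilon> + (2 * C) * M.prob {\<omega>\<in>space M. \<omega> \<in> {\<omega>. W n \<omega> \<notin> K}}"
      proof (intro M.expectation_diff_le int)
        show "\<bar>\<phi> (Z n \<omega>) - \<phi> (W n \<omega>)\<bar> \<le> 2 * C" for \<omega>
          using C[of "Z n \<omega>"] C[of "W n \<omega>"] by linarith
        show "\<bar>\<phi> (Z n \<omega>) - \<phi> (W n \<omega>)\<bar> \<le> \<epsilon>" if "\<omega> \<in> space M" "\<omega> \<notin> {\<omega>. W n \<omega> \<notin> K}" for \<omega>
          using \<delta>(2)[of "W n \<omega>" "Z n \<omega>"] elim that by (auto simp: dist_real_def less_imp_le)
      qed (use \<epsilon> in auto)
      also have "\<dots> \<le> \<epsilon> + 2 * C * \<epsilon>"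
        using K(2)[of n] \<open>0 \<le> C\<close> by (intro add_left_mono mult_left_mono) auto
      finally show ?case using \<epsilon>r by (simp add: dist_real_def)
    qed
  qed
  from tendsto_add[OF this conv[OF \<phi>]] show "(\<lambda>n. \<integral>\<omega>. \<phi> (Z n \<omega>) \<partial>M) \<longlonglongrightarrow> (\<integral>\<omega>. \<phi> (Y \<omega>) \<partial>N)"
    by simp
qed

text \<open>Markov's inequality for each partial sum, followed by continuity of measure along the
  increasing events.\<close>

lemma (in prob_space) prob_not_weighted_ball_le:
  assumes Z: "Z \<in> M \<rightarrow>\<^sub>M borel"
    and int: "\<And>x. integrable M (\<lambda>\<omega>. (coord (Z \<omega>) x)\<^sup>2)"
    and v: "\<And>x. expectation (\<lambda>\<omega>. (coord (Z \<omega>) x)\<^sup>2) \<le> p x"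
    and c: "\<And>x. 0 < c x" "\<And>n. (\<Sum>x<n. c x * p x) \<le> C" and "0 < B"
  shows "prob {\<omega>\<in>space M. Z \<omega> \<notin> weighted_ball c B} \<le> C / B"
proof -
  note [measurable] = Z
  define S where "S n \<omega> = (\<Sum>x<n. c x * (coord (Z \<omega>) x)\<^sup>2)" for n \<omega>
  have S_int: "integrable M (S n)" for n unfolding S_def using int by simp
  have [measurable]: "S n \<in> borel_measurable M" for n unfolding S_def by measurable
  have S_mono: "S m \<omega> \<le> S n \<omega>" if "m \<le> n" for m n \<omega>
    unfolding S_def using that c(1) by (intro sum_mono2) (auto simp: less_imp_le)
  have S_nonneg: "0 \<le> S n \<omega>" for n \<omega> using S_mono[of 0 n \<omega>] by (simp add: S_def)
  have "prob {\<omega>\<in>space M. B \<le> S n \<omega>} \<le> C / B" for n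
  proof -
    have "prob {\<omega>\<in>space M. B \<le> S n \<omega>} \<le> expectation (S n) / B"
      using S_nonneg S_int \<open>0 < B\<close>
      by (intro integral_Markov_inequality_measure[where A = "space M"]) simp_all
    also have "expectation (S n) = (\<Sum>x<n. c x * expectation (\<lambda>\<omega>. (coord (Z \<omega>) x)\<^sup>2))"
      unfolding S_def using int by simp
    also have "\<dots> \<le> (\<Sum>x<n. c x * p x)"
      using v c(1) by (intro sum_mono mult_left_mono) (auto simp: less_imp_le)
    also have "\<dots> \<le> C" by (rule c)
    finally show ?thesis using \<open>0 < B\<close> by (simp add: divide_right_mono)
  qed
  \<comment> \<open>With the strict inequality the union over \<open>n\<close> is exactly the
    complement of the ball.\<close>
  then have "prob {\<omega>\<in>space M. B < S n \<omega>} \<le> C / B" for n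
    by (intro order_trans[OF finite_measure_mono \<open>prob {\<omega>\<in>space M. B \<le> S n \<omega>} \<le> C / B\<close>]) auto
  moreover have "(\<lambda>n. prob {\<omega>\<in>space M. B < S n \<omega>}) \<longlonglongrightarrow> prob (\<Union>n. {\<omega>\<in>space M. B < S n \<omega>})"
    using S_mono by (intro finite_Lim_measure_incseq) (auto simp: incseq_def intro: less_le_trans)
  moreover have "(\<Union>n. {\<omega>\<in>space M. B < S n \<omega>}) = {\<omega>\<in>space M. Z \<omega> \<notin> weighted_ball c B}"
    by (auto simp: weighted_ball_def S_def not_le)
  ultimately show ?thesis by (auto intro: LIMSEQ_le_const2)
qed

text \<open>The weights are the reciprocal square roots of the tail sums \<open>t\<close>, since
  \<open>(t\<^sub>x - t\<^sub>x\<^sub>+\<^sub>1) / sqrt t\<^sub>x\<close> is at most \<open>2 (sqrt t\<^sub>x - sqrt t\<^sub>x\<^sub>+\<^sub>1)\<close>.\<close>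

lemma summable_weights:
  fixes p :: "nat \<Rightarrow> real"
  assumes p: "\<And>x. 0 < p x" "summable p"
  obtains c C where "mono c" "\<And>x. 0 < c x" "filterlim c at_top sequentially"
    "\<And>n. (\<Sum>x<n. c x * p x) \<le> C"
proof -
  define t where "t x = (\<Sum>y. p (y + x))" for x
  have sm: "summable (\<lambda>y. p (y + x))" for x using p(2) by (simp add: summable_iff_shift)
  have t_pos: "0 < t x" for x unfolding t_def using p sm by (intro suminf_pos) auto
  have t_Suc: "t x = p x + t (Suc x)" for x
    using suminf_split_head[OF sm[of x]] by (simp add: t_def)
  have "t x = suminf p - (\<Sum>y<x. p y)" for x
    unfolding t_def using suminf_split_initial_segment[OF p(2), of x] by linarith
  then have "t = (\<lambda>x. suminf p - (\<Sum>y<x. p y))" by blast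
  then have t_lim: "t \<longlonglongrightarrow> 0"
    using tendsto_diff[OF tendsto_const summable_LIMSEQ[OF p(2)], of "suminf p"] by simp
  define c where "c x = 1 / sqrt (t x)" for x
  show ?thesis
  proof (rule that)
    show "0 < c x" for x using t_pos by (simp add: c_def)
    have "t (Suc x) \<le> t x" for x using t_Suc[of x] p(1)[of x] by simp
    then show "mono c" unfolding mono_iff_le_Suc c_def
      using t_pos by (auto intro!: divide_left_mono)
    have "filterlim (\<lambda>x. sqrt (t x)) (at_right 0) sequentially"
      using tendsto_real_sqrt[OF t_lim] t_pos order.strict_implies_not_eq[OF t_pos]
      by (auto simp: filterlim_at intro!: always_eventually)
    then show "filterlim c at_top sequentially"
      unfolding c_def using filterlim_compose[OF filterlim_inverse_at_top_right] by (simp add: inverse_eq_divide)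
    have le: "c x * p x \<le> 2 * (sqrt (t x) - sqrt (t (Suc x)))" for x
    proof -
      let ?a = "sqrt (t x)" and ?b = "sqrt (t (Suc x))"
      have "t (Suc x) \<le> t x" using t_Suc[of x] p(1)[of x] by simp
      then have ab: "0 < ?a" "0 < ?b" "?b \<le> ?a" using t_pos by auto
      have "?a\<^sup>2 = t x" "?b\<^sup>2 = t (Suc x)" using t_pos by (simp_all add: less_imp_le)
      then have "p x = ?a\<^sup>2 - ?b\<^sup>2" using t_Suc[of x] by linarith
      also have "\<dots> = (?a - ?b) * (?a + ?b)" by (simp add: power2_eq_square algebra_simps)
      also have "\<dots> \<le> (?a - ?b) * (2 * ?a)" using ab by (intro mult_left_mono) auto
      finally show ?thesis using ab by (simp add: c_def field_simps)
    qed
    have "(\<Sum>x<n. c x * p x) \<le> 2 * (sqrt (t 0) - sqrt (t n))" for n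
    proof (induction n)
      case (Suc n)
      then show ?case using le[of n] by simp
    qed simp
    then show "(\<Sum>x<n. c x * p x) \<le> 2 * sqrt (t 0)" for n
      using t_pos[of n] by (smt (verit) real_sqrt_gt_zero)
  qed
qed

section \<open>Fluctuation processes of shape operators\<close>

text \<open>A common form for all estimators; the identity as \<open>T\<close> gives the unmodified
  empirical process.\<close>

definition shape_fluctuation ::
  "(real list \<Rightarrow> real list) \<Rightarrow> nat pmf \<Rightarrow> (nat \<Rightarrow> 'a \<Rightarrow> nat) \<Rightarrow> nat \<Rightarrow> 'a \<Rightarrow> ell2"
  where "shape_fluctuation T p X n \<omega> =
    Abs_ell2 (\<lambda>x. sqrt (real n) * (extend_zero (T (empirical_vector X n \<omega>)) x - pmf p x))"

abbreviation empirical_fluctuation :: "nat pmf \<Rightarrow> (nat \<Rightarrow> 'a \<Rightarrow> nat) \<Rightarrow> nat \<Rightarrow> 'a \<Rightarrow> ell2"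
  where "empirical_fluctuation \<equiv> shape_fluctuation (\<lambda>w. w)"

lemma coord_shape_fluctuation: "coord (shape_fluctuation T p X n \<omega>) x =
    sqrt (real n) * (extend_zero (T (empirical_vector X n \<omega>)) x - pmf p x)"
  by (simp add: shape_fluctuation_def coord_Abs_ell2 summable_fluctuation_square)

lemma fluctuation_R_eq: "fluctuation_R = shape_fluctuation rear"
  by (intro ext) (simp add: fluctuation_R_def shape_fluctuation_def rearrangement_estimator_def)

lemma fluctuation_G_eq: "fluctuation_G = shape_fluctuation gren"
  by (intro ext) (simp add: fluctuation_G_def shape_fluctuation_def grenander_estimator_def)

section \<open>The empirical process as a normalised sum\<close>

lemma extend_zero_empirical_vector:
  assumes "0 < n"
  shows "extend_zero (empirical_vector X n \<omega>) x = empirical X n \<omega> x"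
proof (cases "x \<le> Max ((\<lambda>i. X i \<omega>) ` {..<n})")
  case True
  then show ?thesis
    by (simp add: extend_zero_def empirical_vector_def del: upt_Suc)
next
  case False
  then have "x \<notin> (\<lambda>i. X i \<omega>) ` {..<n}"
    using Max_ge[of "(\<lambda>i. X i \<omega>) ` {..<n}" x] by auto
  then have "{i. i < n \<and> X i \<omega> = x} = {}" by auto
  with False show ?thesis
    by (simp add: extend_zero_def empirical_vector_def empirical_def del: upt_Suc)
qed

lemma empirical_vector_nonempty: "empirical_vector X n \<omega> \<noteq> []"
  by (simp add: empirical_vector_def)

lemma empirical_vector_nonneg: "u \<in> set (empirical_vector X n \<omega>) \<Longrightarrow> 0 \<le> u"
  by (auto simp: empirical_vector_def empirical_def)

text \<open>The form to which second moments and the central limit theorem apply. For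
  \<open>n = 0\<close> both sides are 0, the right one by division by zero.\<close>

lemma coord_empirical_fluctuation:
  "coord (empirical_fluctuation p X n \<omega>) x = (\<Sum>i<n. of_bool (X i \<omega> = x) - pmf p x) / sqrt (real n)"
proof (cases "n = 0")
  case False
  have "{i. i < n \<and> X i \<omega> = x} = {..<n} \<inter> {i. X i \<omega> = x}" by auto
  then have "empirical X n \<omega> x = (\<Sum>i<n. of_bool (X i \<omega> = x)) / real n"
    by (simp add: empirical_def)
  moreover have "sqrt (real n) * (S / real n - q) = (S - real n * q) / sqrt (real n)" for S q
    using False by (simp add: field_simps)
  ultimately show ?thesis
    using False by (simp add: coord_shape_fluctuation extend_zero_empirical_vector sum_subtractf)
qed (simp add: coord_shape_fluctuation)

lemma finite_functional_empirical_fluctuation: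
  "finite_functional k a (empirical_fluctuation p X n \<omega>) =
    (\<Sum>i<n. (\<Sum>x<k. a x * of_bool (X i \<omega> = x)) - (\<Sum>x<k. a x * pmf p x)) / sqrt (real n)"
  unfolding finite_functional_def coord_empirical_fluctuation sum_subtractf[symmetric]
    right_diff_distrib[symmetric]
  by (subst sum.swap) (simp add: sum_divide_distrib sum_distrib_left)

text \<open>The estimators depend on the sample only through the list of its values, which ranges over
  a countable set; this makes every shape operator measurable.\<close>

lemma shape_fluctuation_list:
  "shape_fluctuation T p X n \<omega> = shape_fluctuation T p (\<lambda>i xs. xs ! i) n (map (\<lambda>i. X i \<omega>) [0..<n])"
proof -
  have "{i. i < n \<and> map (\<lambda>i. X i \<omega>) [0..<n] ! i = x} = {i. i < n \<and> X i \<omega> = x}" for x by auto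
  then have "empirical (\<lambda>i xs. xs ! i) n (map (\<lambda>i. X i \<omega>) [0..<n]) = empirical X n \<omega>"
    by (intro ext) (simp add: empirical_def)
  moreover have "(\<lambda>i. map (\<lambda>i. X i \<omega>) [0..<n] ! i) ` {..<n} = (\<lambda>i. X i \<omega>) ` {..<n}"
    by (intro image_cong) auto
  ultimately have "empirical_vector (\<lambda>i xs. xs ! i) n (map (\<lambda>i. X i \<omega>) [0..<n]) = empirical_vector X n \<omega>"
    by (simp add: empirical_vector_def del: upt_Suc)
  then show ?thesis by (simp add: shape_fluctuation_def)
qed

lemma measurable_shape_fluctuation:
  fixes X :: "nat \<Rightarrow> 'a \<Rightarrow> nat"
  assumes X [measurable]: "\<And>i. X i \<in> M \<rightarrow>\<^sub>M count_space UNIV"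
  shows "shape_fluctuation T p X n \<in> M \<rightarrow>\<^sub>M borel"
proof -
  have "(\<lambda>\<omega>. map (\<lambda>i. X i \<omega>) [0..<n]) \<in> M \<rightarrow>\<^sub>M count_space UNIV"
    unfolding measurable_count_space_eq_countable[OF countableI_type]
  proof (intro conjI ballI)
    fix ys :: "nat list"
    have "map (\<lambda>i. X i \<omega>) [0..<n] = ys \<longleftrightarrow> length ys = n \<and> (\<forall>i<n. X i \<omega> = ys ! i)" for \<omega>
      unfolding list_eq_iff_nth_eq by auto
    then have "(\<lambda>\<omega>. map (\<lambda>i. X i \<omega>) [0..<n]) -` {ys} \<inter> space M =
        {\<omega>\<in>space M. length ys = n \<and> (\<forall>i<n. X i \<omega> = ys ! i)}"
      by blast
    also have "\<dots> \<in> sets M" by measurable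
    finally show "(\<lambda>\<omega>. map (\<lambda>i. X i \<omega>) [0..<n]) -` {ys} \<inter> space M \<in> sets M" .
  qed simp
  then have "(\<lambda>\<omega>. shape_fluctuation T p (\<lambda>i xs. xs ! i) n (map (\<lambda>i. X i \<omega>) [0..<n])) \<in> M \<rightarrow>\<^sub>M borel"
    by (rule measurable_compose) simp
  moreover have "shape_fluctuation T p X n =
      (\<lambda>\<omega>. shape_fluctuation T p (\<lambda>i xs. xs ! i) n (map (\<lambda>i. X i \<omega>) [0..<n]))"
    by (intro ext shape_fluctuation_list)
  ultimately show ?thesis by (simp only:)
qed

section \<open>Closeness to the empirical process on weighted balls\<close>

lemma pos_of_strictly_decreasing:
  fixes p :: "nat pmf"
  assumes "\<And>x. pmf p x > pmf p (Suc x)"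
  shows "0 < pmf p x"
  using assms[of x] pmf_nonneg[of p "Suc x"] by linarith

lemma summable_pmf: "summable (pmf p)" for p :: "nat pmf"
  using pmf_abs_summable[of p UNIV] abs_summable_summable abs_summable_equivalent
  by (metis summable_on_imp_summable)

text \<open>Membership in the ball controls the deviation from \<open>p\<close> deterministically,
  so the threshold for \<open>n\<close> does not depend on \<open>\<omega>\<close>.\<close>

lemma shape_fluctuation_close:
  fixes X :: "nat \<Rightarrow> 'a \<Rightarrow> nat" and p :: "nat pmf"
  assumes T: "shape_operator T" and p: "\<And>x. pmf p x > pmf p (Suc x)"
    and c: "mono c" "\<And>x. 0 < c x" "filterlim c at_top sequentially" and "0 < \<delta>"
  shows "\<forall>\<^sub>F n in sequentially. \<forall>\<omega>. empirical_fluctuation p X n \<omega> \<in> weighted_ball c B \<longrightarrow>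
    dist (shape_fluctuation T p X n \<omega>) (empirical_fluctuation p X n \<omega>) < \<delta>"
proof -
  \<comment> \<open>The first \<open>k\<close> coordinates will agree, so the two doubled tails may
    use all of \<open>\<delta>\<^sup>2\<close>.\<close>
  have "\<forall>\<^sub>F k in sequentially. 4 * \<bar>B\<bar> / \<delta>\<^sup>2 < c k"
    using c(3) by (auto simp: filterlim_at_top_dense)
  then obtain k where "4 * \<bar>B\<bar> / \<delta>\<^sup>2 < c k" by (auto simp: eventually_sequentially)
  then have k: "4 * (B / c k) < \<delta>\<^sup>2"
    using c(2)[of k] \<open>0 < \<delta>\<close> by (simp add: field_simps abs_if split: if_splits)
  \<comment> \<open>At most half the smallest of the first \<open>k\<close> gaps of
    \<open>p\<close>: two deviations below \<open>\<gamma>\<close> cannot reverse an order.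
    Inserting 1 keeps the minimum defined for \<open>k = 0\<close>.\<close>
  obtain \<gamma> where \<gamma>: "0 < \<gamma>" "\<And>i. i < k \<Longrightarrow> 2 * \<gamma> \<le> pmf p i - pmf p (Suc i)"
  proof
    let ?\<gamma> = "Min (insert 1 ((\<lambda>i. (pmf p i - pmf p (Suc i)) / 2) ` {..<k}))"
    show "0 < ?\<gamma>" using p by simp
    show "2 * ?\<gamma> \<le> pmf p i - pmf p (Suc i)" if "i < k" for i
    proof -
      have "?\<gamma> \<le> (pmf p i - pmf p (Suc i)) / 2" using that by (intro Min_le) auto
      then show ?thesis by (simp only: mult.commute[of 2] le_divide_eq_numeral1)
    qed
  qed
  \<comment> \<open>The tail bound at index 0 bounds the squared norm of the process by
    \<open>B / c 0\<close>; dividing by \<open>n\<close> brings every squared deviation below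
    \<open>\<gamma>\<^sup>2\<close>.\<close>
  have "\<forall>\<^sub>F n in sequentially. B / c 0 / \<gamma>\<^sup>2 < real n"
    using filterlim_real_sequentially by (auto simp: filterlim_at_top_dense)
  then show ?thesis
    using eventually_gt_at_top[of 0]
  proof eventually_elim
    case (elim n)
    show ?case
    proof (intro allI impI)
      fix \<omega>
      define w where "w = empirical_vector X n \<omega>"
      define W where "W = empirical_fluctuation p X n \<omega>"
      define Z where "Z = shape_fluctuation T p X n \<omega>"
      assume "empirical_fluctuation p X n \<omega> \<in> weighted_ball c B"
      then have "\<And>m. (\<Sum>x<m. c x * (coord W x)\<^sup>2) \<le> B" by (simp add: W_def weighted_ball_def)
      note tail = weighted_tail_le(2)[OF c(1,2) this]
      have W: "coord W x = sqrt (real n) * (extend_zero w x - pmf p x)" for x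
        by (simp add: W_def w_def coord_shape_fluctuation)
      have Z: "coord Z x = sqrt (real n) * (extend_zero (T w) x - pmf p x)" for x
        by (simp add: Z_def w_def coord_shape_fluctuation)
      have w: "w \<noteq> []" "\<forall>u\<in>set w. 0 \<le> u"
        by (auto simp: w_def empirical_vector_nonempty empirical_vector_nonneg)
      note T' = T[unfolded shape_operator_def, rule_format, OF w(1), OF w(2)[rule_format]]
      have len: "length (T w) = length w" using T' by blast
      have close: "\<bar>extend_zero w x - pmf p x\<bar> < \<gamma>" for x
      proof -
        have "real n * (extend_zero w x - pmf p x)\<^sup>2 = (coord W x)\<^sup>2"
          by (simp add: W power_mult_distrib)
        also have "\<dots> \<le> B / c 0"
          using coord_square_le_norm[of W x] tail[of 0] by (simp add: norm_ell2_eq)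
        also have "\<dots> < real n * \<gamma>\<^sup>2" using elim(1) \<gamma>(1) pos_divide_less_eq[of "\<gamma>\<^sup>2" "B / c 0" "real n"] by simp
        finally have "(extend_zero w x - pmf p x)\<^sup>2 < \<gamma>\<^sup>2" using elim(2) by simp
        then show ?thesis using \<gamma>(1) by (metis abs_le_square_iff abs_of_pos linorder_not_le)
      qed
      have "\<forall>i<k. \<forall>j<length w. i \<le> j \<longrightarrow> w ! j \<le> w ! i"
      proof (intro allI impI)
        fix i j assume ij: "i < k" "j < length w" "i \<le> j"
        show "w ! j \<le> w ! i"
        proof (cases "i = j")
          case False
          \<comment> \<open>However far \<open>j\<close> lies beyond \<open>k\<close>, the gap
            directly after \<open>i\<close> separates the two values.\<close>
          then have "pmf p j \<le> pmf p (Suc i)"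
            using ij(3) lift_Suc_antimono_le[of "pmf p" "Suc i" j] p by (simp add: less_imp_le)
          with \<gamma>(2)[OF ij(1)] close[of i] close[of j] show ?thesis
            using ij by (simp add: extend_zero_def)
        qed simp
      qed
      then have "\<forall>i<min k (length w). T w ! i = w ! i" using T' by blast
      then have head: "coord Z x = coord W x" if "x < k" for x
        using that by (simp add: Z W extend_zero_def len)
      have "(\<Sum>x<length w. (T w ! x - pmf p x)\<^sup>2) \<le> (\<Sum>x<length w. (w ! x - pmf p x)\<^sup>2)"
        using T' p by (simp add: less_imp_le)
      then have "real n * (\<Sum>x<length w. (T w ! x - pmf p x)\<^sup>2) \<le> real n * (\<Sum>x<length w. (w ! x - pmf p x)\<^sup>2)"
        by (intro mult_left_mono) simp_all
      then have "(\<Sum>x<length w. (coord Z x)\<^sup>2) \<le> (\<Sum>x<length w. (coord W x)\<^sup>2)"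
        by (simp add: Z W power_mult_distrib extend_zero_def len sum_distrib_left)
      moreover have "coord Z (x + length w) = coord W (x + length w)" for x
        by (simp add: Z W extend_zero_def len)
      ultimately have "(\<Sum>x. (coord Z x)\<^sup>2) \<le> (\<Sum>x. (coord W x)\<^sup>2)"
        using suminf_split_initial_segment[OF summable_coord_square, of Z "length w"]
          suminf_split_initial_segment[OF summable_coord_square, of W "length w"] by simp
      \<comment> \<open>Cancelling the common head turns the comparison of norms into one of
        tails.\<close>
      then have "(\<Sum>x. (coord Z (x + k))\<^sup>2) \<le> (\<Sum>x. (coord W (x + k))\<^sup>2)"
        using suminf_split_initial_segment[OF summable_coord_square, of Z k]
          suminf_split_initial_segment[OF summable_coord_square, of W k] by (simp add: head)
      with norm_diff_square_le[of Z W k] tail[of k] have "(norm (Z - W))\<^sup>2 \<le> 4 * (B / c k)"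
        by (simp add: head)
      also note k
      finally show "dist (shape_fluctuation T p X n \<omega>) (empirical_fluctuation p X n \<omega>) < \<delta>"
        using \<open>0 < \<delta>\<close> by (simp add: dist_norm Z_def[symmetric] W_def[symmetric] power_less_imp_less_base)
    qed
  qed
qed

section \<open>Moments and the central limit theorem for an independent sample\<close>

lemma expectation_pmf_point: "measure_pmf.expectation p (\<lambda>u. of_bool (u = x)) = pmf p x"
proof -
  have "(\<lambda>u. of_bool (u = x)) = indicat_real {x}" by (auto simp: indicator_def)
  then show ?thesis by (simp add: measure_pmf_single)
qed

lemma integrable_pmf_bounded:
  fixes h :: "'a \<Rightarrow> real"
  assumes "\<And>u. \<bar>h u\<bar> \<le> C"
  shows "integrable (measure_pmf p) h"
  using assms by (intro measure_pmf.integrable_const_bound[of _ C]) auto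

lemma expectation_pmf_finite_support:
  fixes p :: "nat pmf"
  shows "measure_pmf.expectation p (\<lambda>u. if u < k then a u else 0) = (\<Sum>x<k. a x * pmf p x)"
proof -
  have "(if u < k then a u else 0) = (\<Sum>x<k. a x * of_bool (u = x))" for u
    by (simp add: of_bool_def if_distrib[of "\<lambda>s. _ * s"] cong: if_cong)
  then have "measure_pmf.expectation p (\<lambda>u. if u < k then a u else 0) =
      measure_pmf.expectation p (\<lambda>u. \<Sum>x<k. a x * of_bool (u = x))"
    by (simp only:)
  moreover have "integrable (measure_pmf p) (\<lambda>u. a x * of_bool (u = x))" for x
    by (intro integrable_pmf_bounded[of _ "\<bar>a x\<bar>"]) auto
  ultimately show ?thesis by (simp add: expectation_pmf_point del: sum_mult_of_bool_eq)
qed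

locale iid_sample = prob_space M for M :: "'a measure" +
  fixes X :: "nat \<Rightarrow> 'a \<Rightarrow> nat" and p :: "nat pmf"
  assumes indep: "indep_vars (\<lambda>_. count_space UNIV) X UNIV"
    and law: "\<And>i. distr M (count_space UNIV) (X i) = measure_pmf p"
begin

lemma X_measurable [measurable]: "X i \<in> M \<rightarrow>\<^sub>M count_space UNIV"
  using indep unfolding indep_vars_def2 by simp

lemma expectation_sample: "expectation (\<lambda>\<omega>. h (X i \<omega>) :: real) = measure_pmf.expectation p h"
  unfolding law[of i, symmetric] by (subst integral_distr) simp_all

lemma integrable_sample:
  fixes h :: "nat \<Rightarrow> real"
  assumes "\<And>u. \<bar>h u\<bar> \<le> C"
  shows "integrable M (\<lambda>\<omega>. h (X i \<omega>))"
  using assms by (intro integrable_const_bound[of _ C]) auto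

lemma indep_sample: "indep_vars (\<lambda>_. borel) (\<lambda>i \<omega>. h (X i \<omega>) :: real) UNIV"
  by (rule indep_vars_compose2[OF indep]) simp

lemma expectation_sample_product:
  fixes h :: "nat \<Rightarrow> real"
  assumes h: "\<And>u. \<bar>h u\<bar> \<le> C" and "i \<noteq> j"
  shows "expectation (\<lambda>\<omega>. h (X i \<omega>) * h (X j \<omega>)) = (measure_pmf.expectation p h)\<^sup>2"
  using indep_vars_lebesgue_integral[of "{i, j}" "\<lambda>i \<omega>. h (X i \<omega>)"]
    indep_vars_subset[OF indep_sample[of h], of "{i, j}"] integrable_sample[of h, OF h] \<open>i \<noteq> j\<close>
  by (simp add: expectation_sample power2_eq_square)

text \<open>Off the diagonal the expectations factor by independence and vanish.\<close>

lemma expectation_sum_square: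
  fixes h :: "nat \<Rightarrow> real"
  assumes h: "\<And>u. \<bar>h u\<bar> \<le> C" and mean: "measure_pmf.expectation p h = 0"
  shows "expectation (\<lambda>\<omega>. (\<Sum>i<n. h (X i \<omega>))\<^sup>2) = real n * measure_pmf.expectation p (\<lambda>u. (h u)\<^sup>2)"
proof -
  have C: "\<bar>h u * h v\<bar> \<le> C * C" for u v
    using h[of u] h[of v] by (simp add: abs_mult mult_mono')
  have int: "integrable M (\<lambda>\<omega>. h (X i \<omega>) * h (X j \<omega>))" for i j
    using C by (intro integrable_const_bound[of _ "C * C"]) auto
  have E: "expectation (\<lambda>\<omega>. h (X i \<omega>) * h (X j \<omega>)) =
      (if i = j then measure_pmf.expectation p (\<lambda>u. (h u)\<^sup>2) else 0)" for i j
    using expectation_sample_product[of h, OF h, of i j] expectation_sample[of "\<lambda>u. h u * h u" i]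
    by (auto simp: mean power2_eq_square)
  have "expectation (\<lambda>\<omega>. (\<Sum>i<n. h (X i \<omega>))\<^sup>2) =
      (\<Sum>i<n. \<Sum>j<n. expectation (\<lambda>\<omega>. h (X i \<omega>) * h (X j \<omega>)))"
    using int by (simp add: power2_eq_square sum_product)
  then show ?thesis by (simp add: E)
qed

lemma measurable_fluctuation [measurable]: "shape_fluctuation T p X n \<in> M \<rightarrow>\<^sub>M borel"
  by (rule measurable_shape_fluctuation) simp

text \<open>For \<open>n > 0\<close> the second moment is the Bernoulli variance. Its bound by
  \<open>pmf p x\<close> is uniform in \<open>n\<close> and matches the weights.\<close>

lemma empirical_coord_square:
  shows "integrable M (\<lambda>\<omega>. (coord (empirical_fluctuation p X n \<omega>) x)\<^sup>2)"
    and "expectation (\<lambda>\<omega>. (coord (empirical_fluctuation p X n \<omega>) x)\<^sup>2) \<le> pmf p x"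
proof -
  define h where "h = (\<lambda>u. of_bool (u = x) - pmf p x)"
  have eq: "(coord (empirical_fluctuation p X n \<omega>) x)\<^sup>2 = (\<Sum>i<n. h (X i \<omega>))\<^sup>2 / real n" for \<omega>
    by (simp add: coord_empirical_fluctuation h_def power_divide)
  have h: "\<bar>h u\<bar> \<le> 1" for u
    using pmf_le_1[of p x] pmf_nonneg[of p x] unfolding h_def of_bool_def by auto
  have "\<bar>\<Sum>i<n. h (X i \<omega>)\<bar> \<le> real n" for \<omega>
    using sum_bounded_above[of "{..<n}" "\<lambda>i. \<bar>h (X i \<omega>)\<bar>" 1] h
    by (auto intro: order_trans[OF sum_abs])
  then have "(\<Sum>i<n. h (X i \<omega>))\<^sup>2 \<le> (real n)\<^sup>2" for \<omega>
    by (metis abs_le_square_iff abs_of_nat)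
  then have "integrable M (\<lambda>\<omega>. (\<Sum>i<n. h (X i \<omega>))\<^sup>2)"
    by (intro integrable_const_bound[of _ "(real n)\<^sup>2"]) auto
  then show "integrable M (\<lambda>\<omega>. (coord (empirical_fluctuation p X n \<omega>) x)\<^sup>2)"
    unfolding eq by simp
  have int: "integrable (measure_pmf p) (\<lambda>u. of_bool (u = x) :: real)"
    by (rule integrable_pmf_bounded[of _ 1]) simp
  have "measure_pmf.expectation p h = 0"
    using int by (simp add: h_def expectation_pmf_point)
  \<comment> \<open>An indicator equals its square, so the square is affine in it.\<close>
  moreover have "(h u)\<^sup>2 = (1 - 2 * pmf p x) * of_bool (u = x) + (pmf p x)\<^sup>2" for u
    by (simp add: h_def power2_eq_square algebra_simps)
  then have "measure_pmf.expectation p (\<lambda>u. (h u)\<^sup>2) =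
      measure_pmf.expectation p (\<lambda>u. (1 - 2 * pmf p x) * of_bool (u = x) + (pmf p x)\<^sup>2)"
    by (simp only:)
  then have "measure_pmf.expectation p (\<lambda>u. (h u)\<^sup>2) = pmf p x - (pmf p x)\<^sup>2"
    using int by (simp add: expectation_pmf_point power2_eq_square left_diff_distrib)
  ultimately have "expectation (\<lambda>\<omega>. (coord (empirical_fluctuation p X n \<omega>) x)\<^sup>2) =
      real n * (pmf p x - (pmf p x)\<^sup>2) / real n"
    unfolding eq using expectation_sum_square[of h, OF h, of n] by simp
  then show "expectation (\<lambda>\<omega>. (coord (empirical_fluctuation p X n \<omega>) x)\<^sup>2) \<le> pmf p x"
    by (cases "n = 0") simp_all
qed

end

section \<open>Second moments of the Gaussian limit\<close>

lemma (in prob_space) centered_normal_cases: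
  assumes V: "normal_rv M V" and mean: "expectation V = 0"
  obtains (degenerate) "AE \<omega> in M. V \<omega> = 0"
  | (normal) s where "0 < s" "distributed M lborel V (normal_density 0 s)"
proof -
  have [measurable]: "V \<in> borel_measurable M" using V by (simp add: normal_rv_def)
  obtain m where m: "(AE \<omega> in M. V \<omega> = m) \<or> (\<exists>s>0. distributed M lborel V (normal_density m s))"
    using V by (auto simp: normal_rv_def)
  then show ?thesis
  proof
    assume "AE \<omega> in M. V \<omega> = m"
    moreover from this have "expectation V = expectation (\<lambda>_. m)"
      by (intro integral_cong_AE) auto
    ultimately show ?thesis using mean degenerate by (simp add: prob_space)
  next
    assume "\<exists>s>0. distributed M lborel V (normal_density m s)"
    then obtain s where s: "0 < s" "distributed M lborel V (normal_density m s)" by blast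
    then have "m = 0" using normal_distributed_expectation[OF s] mean by simp
    then show ?thesis using s normal by simp
  qed
qed

text \<open>Bochner integrals of nonintegrable functions are 0, so prescribed covariances alone do
  not give finite second moments; normality does.\<close>

lemma (in prob_space) centered_normal_square_integrable:
  assumes V: "normal_rv M V" and mean: "expectation V = 0"
  shows "integrable M (\<lambda>\<omega>. (V \<omega>)\<^sup>2)"
proof -
  have [measurable]: "V \<in> borel_measurable M" using V by (simp add: normal_rv_def)
  from V mean show ?thesis
  proof (cases rule: centered_normal_cases)
    case degenerate
    then have "integrable M (\<lambda>\<omega>. (V \<omega>)\<^sup>2) \<longleftrightarrow> integrable M (\<lambda>_. 0 :: real)"
      by (intro integrable_cong_AE) auto
    then show ?thesis by simp
  next
    case (normal s)
    then show ?thesis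
      using distributed_integrable[OF normal(2), of "\<lambda>x. x\<^sup>2"]
        integrable_normal_moment[OF normal(1), of 0 2] by simp
  qed
qed

text \<open>Each coordinate is normal as a one-term linear combination; as the means are 0, the
  covariances are plain product moments.\<close>

lemma (in prob_space) limit_process_moments:
  assumes Y: "limit_process p M Y"
  shows "integrable M (\<lambda>\<omega>. coord (Y \<omega>) x * coord (Y \<omega>) y)"
    and "expectation (\<lambda>\<omega>. coord (Y \<omega>) x * coord (Y \<omega>) y) = (if x = y then pmf p x else 0) - pmf p x * pmf p y"
proof -
  have [measurable]: "Y \<in> M \<rightarrow>\<^sub>M borel" and g: "gaussian_process M (\<lambda>x \<omega>. coord (Y \<omega>) x)"
    and mean: "\<And>x. expectation (\<lambda>\<omega>. coord (Y \<omega>) x) = 0"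
    and cov: "\<And>x y. covariance M (\<lambda>\<omega>. coord (Y \<omega>) x) (\<lambda>\<omega>. coord (Y \<omega>) y) =
      (if x = y then pmf p x else 0) - pmf p x * pmf p y"
    using Y unfolding limit_process_def by auto
  have "normal_rv M (\<lambda>\<omega>. coord (Y \<omega>) x)" for x
    using g[unfolded gaussian_process_def, rule_format, of "{x}" "\<lambda>_. 1"] by simp
  then have sq: "integrable M (\<lambda>\<omega>. (coord (Y \<omega>) x)\<^sup>2)" for x
    by (rule centered_normal_square_integrable[OF _ mean])
  show "integrable M (\<lambda>\<omega>. coord (Y \<omega>) x * coord (Y \<omega>) y)"
  proof (rule Bochner_Integration.integrable_bound)
    show "integrable M (\<lambda>\<omega>. (coord (Y \<omega>) x)\<^sup>2 + (coord (Y \<omega>) y)\<^sup>2)" using sq by simp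
    have "\<bar>u * v\<bar> \<le> \<bar>u\<^sup>2 + v\<^sup>2\<bar>" for u v :: real
    proof -
      have "0 \<le> \<bar>u * v\<bar>" "2 * \<bar>u * v\<bar> \<le> u\<^sup>2 + v\<^sup>2"
        using sum_squares_bound[of "\<bar>u\<bar>" "\<bar>v\<bar>"] by (simp_all add: abs_mult)
      then show ?thesis by linarith
    qed
    then show "AE \<omega> in M. norm (coord (Y \<omega>) x * coord (Y \<omega>) y) \<le> norm ((coord (Y \<omega>) x)\<^sup>2 + (coord (Y \<omega>) y)\<^sup>2)"
      by simp
  qed simp
  show "expectation (\<lambda>\<omega>. coord (Y \<omega>) x * coord (Y \<omega>) y) = (if x = y then pmf p x else 0) - pmf p x * pmf p y"
    using cov[of x y] by (simp add: covariance_def mean)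
qed

text \<open>The variance under \<open>p\<close> of \<open>a\<close> cut off to 0 from index
  \<open>k\<close> on, equal to the quadratic form of the limit covariance at
  \<open>a\<close>.\<close>

definition multinomial_variance :: "nat pmf \<Rightarrow> nat \<Rightarrow> (nat \<Rightarrow> real) \<Rightarrow> real"
  where "multinomial_variance p k a = (\<Sum>x<k. (a x)\<^sup>2 * pmf p x) - (\<Sum>x<k. a x * pmf p x)\<^sup>2"

lemma (in prob_space) limit_process_functional:
  assumes Y: "limit_process p M Y"
  shows "normal_rv M (\<lambda>\<omega>. finite_functional k a (Y \<omega>))"
    and "expectation (\<lambda>\<omega>. finite_functional k a (Y \<omega>)) = 0"
    and "expectation (\<lambda>\<omega>. (finite_functional k a (Y \<omega>))\<^sup>2) = multinomial_variance p k a"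
proof -
  have [measurable]: "Y \<in> M \<rightarrow>\<^sub>M borel" and g: "gaussian_process M (\<lambda>x \<omega>. coord (Y \<omega>) x)"
    and mean: "\<And>x. expectation (\<lambda>\<omega>. coord (Y \<omega>) x) = 0"
    using Y unfolding limit_process_def by auto
  show "normal_rv M (\<lambda>\<omega>. finite_functional k a (Y \<omega>))"
    using g[unfolded gaussian_process_def, rule_format, of "{..<k}" a] by (simp add: finite_functional_def)
  note mom = limit_process_moments[OF Y]
  have "integrable M (\<lambda>\<omega>. coord (Y \<omega>) x)" for x
    using square_integrable_imp_integrable[of "\<lambda>\<omega>. coord (Y \<omega>) x"] mom(1)[of x x]
    by (simp add: power2_eq_square)
  then show "expectation (\<lambda>\<omega>. finite_functional k a (Y \<omega>)) = 0"
    by (simp add: finite_functional_def mean)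
  have "expectation (\<lambda>\<omega>. (finite_functional k a (Y \<omega>))\<^sup>2) =
      expectation (\<lambda>\<omega>. \<Sum>x<k. \<Sum>y<k. a x * a y * (coord (Y \<omega>) x * coord (Y \<omega>) y))"
    by (simp add: finite_functional_def power2_eq_square sum_product mult_ac)
  also have "\<dots> = (\<Sum>x<k. \<Sum>y<k. a x * a y * ((if x = y then pmf p x else 0) - pmf p x * pmf p y))"
    using mom by simp
  also have "\<dots> = (\<Sum>x<k. \<Sum>y<k. if x = y then a x * a y * pmf p x else 0) -
      (\<Sum>x<k. \<Sum>y<k. (a x * pmf p x) * (a y * pmf p y))"
    unfolding sum_subtractf[symmetric] by (intro sum.cong) (auto simp: algebra_simps)
  also have "\<dots> = multinomial_variance p k a"
    by (simp add: multinomial_variance_def power2_eq_square sum_product)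
  finally show "expectation (\<lambda>\<omega>. (finite_functional k a (Y \<omega>))\<^sup>2) = multinomial_variance p k a" .
qed

section \<open>One-dimensional limits, tightness and weak convergence\<close>

context iid_sample
begin

text \<open>A finite functional of the empirical process is a normalised sum of the centred bounded
  variables \<open>h (X i \<omega>)\<close>, whose variance is that of \<open>V\<close>.\<close>

lemma empirical_trig_limit:
  assumes N: "prob_space N" and V: "normal_rv N V" "(\<integral>\<omega>. V \<omega> \<partial>N) = 0"
    and var: "(\<integral>\<omega>. (V \<omega>)\<^sup>2 \<partial>N) = multinomial_variance p k a"
  shows "(\<lambda>n. expectation (\<lambda>\<omega>. cos (finite_functional k a (empirical_fluctuation p X n \<omega>) + b)))
    \<longlonglongrightarrow> (\<integral>\<omega>. cos (V \<omega> + b) \<partial>N)"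
proof -
  interpret N: prob_space N by fact
  have [measurable]: "V \<in> borel_measurable N" using V by (simp add: normal_rv_def)
  define m where "m = (\<Sum>x<k. a x * pmf p x)"
  define h where "h = (\<lambda>u. (if u < k then a u else 0) - m)"
  have h_eq: "finite_functional k a (empirical_fluctuation p X n \<omega>) = (\<Sum>i<n. h (X i \<omega>)) / sqrt (real n)" for n \<omega>
    unfolding finite_functional_empirical_fluctuation h_def m_def
    by (simp add: of_bool_def if_distrib[of "\<lambda>s. _ * s"] cong: if_cong)
  define C where "C = (\<Sum>x<k. \<bar>a x\<bar>) + \<bar>m\<bar>"
  have C: "\<bar>h u\<bar> \<le> C" for u
  proof (cases "u < k")
    case True
    then have "\<bar>a u\<bar> \<le> (\<Sum>x<k. \<bar>a x\<bar>)" by (intro member_le_sum) auto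
    with True show ?thesis unfolding h_def C_def by simp
  qed (simp add: h_def C_def sum_nonneg)
  have int: "integrable (measure_pmf p) (\<lambda>u. if u < k then c u else 0)" for c :: "nat \<Rightarrow> real"
  proof (rule integrable_pmf_bounded)
    show "\<bar>if u < k then c u else 0\<bar> \<le> (\<Sum>x<k. \<bar>c x\<bar>)" for u
      by (auto intro!: member_le_sum sum_nonneg)
  qed
  have mean: "measure_pmf.expectation p h = 0"
    unfolding h_def using int by (simp add: expectation_pmf_finite_support m_def)
  have "(h u)\<^sup>2 = (if u < k then (a u)\<^sup>2 - 2 * m * a u else 0) + m\<^sup>2" for u
    by (simp add: h_def power2_eq_square algebra_simps)
  then have "measure_pmf.expectation p (\<lambda>u. (h u)\<^sup>2) =
      measure_pmf.expectation p (\<lambda>u. (if u < k then (a u)\<^sup>2 - 2 * m * a u else 0) + m\<^sup>2)"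
    by (simp only:)
  then have sq: "measure_pmf.expectation p (\<lambda>u. (h u)\<^sup>2) = multinomial_variance p k a"
    using int by (simp add: expectation_pmf_finite_support multinomial_variance_def m_def
        left_diff_distrib sum_subtractf sum_distrib_left[symmetric] mult.assoc power2_eq_square)
  from V show ?thesis
  proof (cases rule: N.centered_normal_cases)
    case degenerate
    \<comment> \<open>The central limit theorem needs positive variance. With variance zero every
      \<open>h (X i \<omega>)\<close> vanishes almost surely, and both expectations are
      \<open>cos b\<close>.\<close>
    then have "(\<integral>\<omega>. (V \<omega>)\<^sup>2 \<partial>N) = (\<integral>\<omega>. 0 \<partial>N)"
      by (intro integral_cong_AE) auto
    then have "expectation (\<lambda>\<omega>. (h (X i \<omega>))\<^sup>2) = 0" for i
      using expectation_sample[of "\<lambda>u. (h u)\<^sup>2" i] sq var by simp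
    moreover have "integrable M (\<lambda>\<omega>. (h (X i \<omega>))\<^sup>2)" for i
      using C by (intro integrable_sample[of "\<lambda>u. (h u)\<^sup>2" "C\<^sup>2"]) (metis abs_ge_zero abs_power2 power2_abs power_mono)
    ultimately have "AE \<omega> in M. h (X i \<omega>) = 0" for i
      using integral_nonneg_eq_0_iff_AE[of M "\<lambda>\<omega>. (h (X i \<omega>))\<^sup>2"] by simp
    then have "AE \<omega> in M. \<forall>i. h (X i \<omega>) = 0" by (simp add: AE_all_countable)
    then have "expectation (\<lambda>\<omega>. cos (finite_functional k a (empirical_fluctuation p X n \<omega>) + b)) =
        expectation (\<lambda>_. cos b)" for n
      unfolding h_eq by (intro integral_cong_AE) auto
    moreover have "(\<integral>\<omega>. cos (V \<omega> + b) \<partial>N) = (\<integral>\<omega>. cos b \<partial>N)"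
      using degenerate by (intro integral_cong_AE) auto
    ultimately show ?thesis by (simp add: prob_space N.prob_space)
  next
    case (normal s)
    then have s: "multinomial_variance p k a = s\<^sup>2"
      using N.normal_distributed_variance[OF normal] V(2) var by simp
    \<comment> \<open>Standardised by \<open>s\<close>; the factor is put back inside the cosine,
      and likewise for \<open>V / s\<close> in the limit.\<close>
    define S where "S n \<omega> = (\<Sum>i<n. h (X i \<omega>)) / sqrt (real n * s\<^sup>2)" for n \<omega>
    have "weak_conv_m (\<lambda>n. distr M borel (S n)) std_normal_distribution"
      unfolding S_def
    proof (rule central_limit_theorem_zero_mean[OF indep_sample _ normal(1)])
      show "expectation (\<lambda>\<omega>. h (X i \<omega>)) = 0" for i by (simp add: expectation_sample mean)
      then show "variance (\<lambda>\<omega>. h (X i \<omega>)) = s\<^sup>2" for i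
        using expectation_sample[of "\<lambda>u. (h u)\<^sup>2" i] sq s by simp
      show "integrable M (\<lambda>\<omega>. (h (X i \<omega>))\<^sup>2)" for i
        using C by (intro integrable_sample[of "\<lambda>u. (h u)\<^sup>2" "C\<^sup>2"]) (metis abs_ge_zero abs_power2 power2_abs power_mono)
      show "distr M borel (\<lambda>\<omega>. h (X i \<omega>)) = distr (measure_pmf p) borel h" for i
        unfolding law[of i, symmetric] by (subst distr_distr) (simp_all add: o_def)
    qed
    then have "(\<lambda>n. \<integral>u. cos (s * u + b) \<partial>distr M borel (S n)) \<longlonglongrightarrow> (\<integral>u. cos (s * u + b) \<partial>std_normal_distribution)"
    proof (rule weak_conv_imp_integral_bdd_continuous_conv[where B = 1, rotated 2])
      show "real_distribution (distr M borel (S n))" for n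
        unfolding S_def by (rule real_distribution_distr) simp
      show "isCont (\<lambda>u. cos (s * u + b)) x" for x by (intro continuous_intros)
    qed (auto intro: real_dist_normal_dist)
    moreover have "(\<integral>u. cos (s * u + b) \<partial>distr M borel (S n)) =
        expectation (\<lambda>\<omega>. cos (finite_functional k a (empirical_fluctuation p X n \<omega>) + b))" for n
    proof (subst integral_distr)
      show "S n \<in> M \<rightarrow>\<^sub>M borel" unfolding S_def by measurable
      have "s * S n \<omega> = (\<Sum>i<n. h (X i \<omega>)) / sqrt (real n)" for \<omega>
        using normal(1) by (simp add: S_def real_sqrt_mult)
      then show "expectation (\<lambda>\<omega>. cos (s * S n \<omega> + b)) =
          expectation (\<lambda>\<omega>. cos (finite_functional k a (empirical_fluctuation p X n \<omega>) + b))"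
        by (simp add: h_eq)
    qed simp
    moreover have "(\<integral>u. cos (s * u + b) \<partial>std_normal_distribution) = (\<integral>\<omega>. cos (V \<omega> + b) \<partial>N)"
    proof -
      have "distributed N lborel (\<lambda>\<omega>. V \<omega> / s) std_normal_density"
        using N.normal_standard_normal_convert[OF normal(1), of V 0] normal(2) by simp
      from distributed_integral[OF this, of "\<lambda>u. cos (s * u + b)"]
      show ?thesis using normal(1) by (simp add: integral_real_density)
    qed
    ultimately show ?thesis by simp
  qed
qed

text \<open>The same weights serve all \<open>n\<close> and \<open>Y\<close>, because all their
  coordinates have second moments at most \<open>pmf p x\<close>.\<close>

lemma tight_weighted_ball:
  assumes p: "\<And>x. 0 < pmf p x" and N: "prob_space N" and Y: "limit_process p N Y"
  obtains c where "mono c" "\<And>x. 0 < c x" "filterlim c at_top sequentially"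
    "\<And>\<epsilon>. 0 < \<epsilon> \<Longrightarrow> \<exists>B.
      (\<forall>n. prob {\<omega>\<in>space M. empirical_fluctuation p X n \<omega> \<notin> weighted_ball c B} \<le> \<epsilon>) \<and>
      measure N {\<omega>\<in>space N. Y \<omega> \<notin> weighted_ball c B} \<le> \<epsilon>"
proof -
  interpret N: prob_space N by fact
  have [measurable]: "Y \<in> N \<rightarrow>\<^sub>M borel" using Y by (simp add: limit_process_def)
  obtain c C where c: "mono c" "\<And>x. 0 < c x" "filterlim c at_top sequentially"
    "\<And>n. (\<Sum>x<n. c x * pmf p x) \<le> C"
    using summable_weights[OF p summable_pmf] by blast
  have "\<exists>B. (\<forall>n. prob {\<omega>\<in>space M. empirical_fluctuation p X n \<omega> \<notin> weighted_ball c B} \<le> \<epsilon>) \<and>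
      measure N {\<omega>\<in>space N. Y \<omega> \<notin> weighted_ball c B} \<le> \<epsilon>" if "0 < \<epsilon>" for \<epsilon>
  proof -
    \<comment> \<open>Makes \<open>C / B\<close> at most \<open>\<epsilon>\<close>, with
      \<open>B\<close> positive whatever the sign of \<open>C\<close>.\<close>
    define B where "B = (\<bar>C\<bar> + 1) / \<epsilon>"
    have "0 < B" using that by (simp add: B_def)
    have "C * \<epsilon> \<le> (\<bar>C\<bar> + 1) * \<epsilon>" using that by (intro mult_right_mono) auto
    then have "C / B \<le> \<epsilon>" using that by (simp add: B_def pos_divide_le_eq mult.commute)
    have "prob {\<omega>\<in>space M. empirical_fluctuation p X n \<omega> \<notin> weighted_ball c B} \<le> C / B" for n
      using empirical_coord_square c(2,4) \<open>0 < B\<close> by (intro prob_not_weighted_ball_le[where p = "pmf p"]) auto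
    moreover have "measure N {\<omega>\<in>space N. Y \<omega> \<notin> weighted_ball c B} \<le> C / B"
    proof (rule N.prob_not_weighted_ball_le[where p = "pmf p"])
      show "integrable N (\<lambda>\<omega>. (coord (Y \<omega>) x)\<^sup>2)" for x
        using N.limit_process_moments(1)[OF Y, of x x] by (simp add: power2_eq_square)
      show "N.expectation (\<lambda>\<omega>. (coord (Y \<omega>) x)\<^sup>2) \<le> pmf p x" for x
        using N.limit_process_moments(2)[OF Y, of x x] by (simp add: power2_eq_square)
    qed (use c \<open>0 < B\<close> in auto)
    ultimately show ?thesis using \<open>C / B \<le> \<epsilon>\<close> by (meson order_trans)
  qed
  with c(1-3) show ?thesis by (rule that)
qed

text \<open>The empirical process converges first; the weighted balls that make it tight then carry
  the perturbation to \<open>T\<close>.\<close>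

theorem shape_fluctuation_converges:
  assumes T: "shape_operator T" and decreasing: "\<And>x. pmf p x > pmf p (Suc x)"
    and N: "prob_space N" and Y: "limit_process p N Y"
  shows "converges_weakly M (shape_fluctuation T p X) N Y"
proof -
  interpret N: prob_space N by fact
  obtain c where c: "mono c" "\<And>x. 0 < c x" "filterlim c at_top sequentially"
    and tight: "\<And>\<epsilon>. 0 < \<epsilon> \<Longrightarrow> \<exists>B.
      (\<forall>n. prob {\<omega>\<in>space M. empirical_fluctuation p X n \<omega> \<notin> weighted_ball c B} \<le> \<epsilon>) \<and>
      measure N {\<omega>\<in>space N. Y \<omega> \<notin> weighted_ball c B} \<le> \<epsilon>"
    using tight_weighted_ball[OF pos_of_strictly_decreasing[OF decreasing] N Y] by blast
  note compact = compact_weighted_ball[OF c]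
  have "converges_weakly M (empirical_fluctuation p X) N Y"
  proof (rule converges_weakly_if_trig)
    show "Y \<in> N \<rightarrow>\<^sub>M borel" using Y by (simp add: limit_process_def)
    show "(\<lambda>n. expectation (\<lambda>\<omega>. cos (finite_functional k a (empirical_fluctuation p X n \<omega>) + b)))
      \<longlonglongrightarrow> N.expectation (\<lambda>\<omega>. cos (finite_functional k a (Y \<omega>) + b))" for k a b
      by (rule empirical_trig_limit[OF N N.limit_process_functional[OF Y]])
    show "\<exists>K. compact K \<and> (\<forall>n. prob {\<omega>\<in>space M. empirical_fluctuation p X n \<omega> \<notin> K} \<le> \<epsilon>) \<and>
      measure N {\<omega>\<in>space N. Y \<omega> \<notin> K} \<le> \<epsilon>" if "0 < \<epsilon>" for \<epsilon>
      using tight[OF that] compact by blast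
  qed (rule prob_space_axioms N measurable_fluctuation)+
  then show ?thesis
  proof (rule converges_weakly_perturb[OF prob_space_axioms])
    fix \<epsilon> :: real
    assume "0 < \<epsilon>"
    then obtain B where B: "\<forall>n. prob {\<omega>\<in>space M. empirical_fluctuation p X n \<omega> \<notin> weighted_ball c B} \<le> \<epsilon>"
      using tight by blast
    have "\<forall>\<^sub>F n in sequentially. \<forall>\<omega>\<in>space M. empirical_fluctuation p X n \<omega> \<in> weighted_ball c B \<longrightarrow>
        dist (shape_fluctuation T p X n \<omega>) (empirical_fluctuation p X n \<omega>) < \<delta>" if "0 < \<delta>" for \<delta>
      using shape_fluctuation_close[OF T decreasing c that, of X B] by (rule eventually_mono) blast
    with B compact[of B] show "\<exists>K. compact K \<and>
        (\<forall>n. prob {\<omega>\<in>space M. empirical_fluctuation p X n \<omega> \<notin> K} \<le> \<epsilon>) \<and>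
        (\<forall>\<delta>>0. \<forall>\<^sub>F n in sequentially. \<forall>\<omega>\<in>space M. empirical_fluctuation p X n \<omega> \<in> K \<longrightarrow>
          dist (shape_fluctuation T p X n \<omega>) (empirical_fluctuation p X n \<omega>) < \<delta>)"
      by blast
  qed (rule measurable_fluctuation)
qed

end

theorem corollary3p9:
  fixes M :: "'a measure" and N :: "'b measure"
    and X :: "nat \<Rightarrow> 'a \<Rightarrow> nat" and p :: "nat pmf" and Y :: "'b \<Rightarrow> ell2"
  assumes "prob_space M"
    and indep: "prob_space.indep_vars M (\<lambda>_. count_space UNIV) X UNIV"
    and law: "\<And>i. distr M (count_space UNIV) (X i) = measure_pmf p"
    and decreasing: "\<And>x. pmf p x > pmf p (Suc x)"
    and "prob_space N"
    and Y: "limit_process p N Y"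
  shows "converges_weakly M (fluctuation_R p X) N Y \<and>
    converges_weakly M (fluctuation_G p X) N Y"
proof -
  interpret iid_sample M X p
    using assms by (simp add: iid_sample_def iid_sample_axioms_def)
  show ?thesis
    unfolding fluctuation_R_eq fluctuation_G_eq
    using shape_fluctuation_converges[OF shape_operator_rear decreasing \<open>prob_space N\<close> Y]
      shape_fluctuation_converges[OF shape_operator_gren decreasing \<open>prob_space N\<close> Y] by simp
qed

end
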